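(* The following problem is undecidable: given a one-counter automaton $\mathcal{A}$, decide whether $\mathcal{A}$ is history-deterministic.
   Context: A one-counter automaton (OCA) is $\mathcal{A}=(Q,\Sigma,\Delta,q_0,F)$ with $Q$ finite, $\Sigma$ finite, $q_0\in Q$, $F\subseteq Q$, and $\Delta\subseteq Q\times\{\mathrm{zero},\neg\mathrm{zero}\}\times\Sigma\times\{-1,0,1\}\times Q$. From configuration $(q,m)\in Q\times\mathbb{N}$ reading $a$: if $m>0$ a transition $(q,\neg\mathrm{zero},a,d,q')$ leads to $(q',m+d)$; if $m=0$ a transition $(q,\mathrm{zero},a,d,q')$ with $d\in\{0,1\}$ leads to $(q',m+d)$. Runs start at $(q_0,0)$, are accepting if the last state is in $F$, and $\mathcal{L}(\mathcal{A})$ is the set of words with an accepting run. The letter game: positions $(c,w)$, start $((q_0,0),\varepsilon)$; each round Adam picks $a\in\Sigma$, Eve picks a transition $c\xrightarrow{a}c'$ available at $c$. If Eve has none and $wa$ is a prefix of a word in $\mathcal{L}(\mathcal{A})$, Eve loses; if $wa\in\mathcal{L}(\mathcal{A})$ but the state of $c'$ is not in $F$, Adam wins; otherwise play continues from $(c',wa)$, and Eve wins infinite plays. $\mathcal{A}$ is history-deterministic if Eve has a winning strategy in the letter game. *)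

theory Defs
  imports Main "HOL-Library.Nat_Bijection"
begin

text \<open>States are 0..<nstates, letters are 0..<nletters. A transition
(q, z, a, d, q') has zero-test flag z (True = zero, False = not zero),
letter a, counter update d, target q'.\<close>

type_synonym trans = "nat \<times> bool \<times> nat \<times> int \<times> nat"

record oca =
  nstates :: nat
  nletters :: nat
  delta :: "trans list"
  init :: nat
  final :: "nat list"

definition oca_wf :: "oca \<Rightarrow> bool" where
  "oca_wf A \<longleftrightarrow> init A < nstates A \<and> (\<forall>q\<in>set (final A). q < nstates A) \<and>
     (\<forall>(q, z, a, d, q')\<in>set (delta A).
        q < nstates A \<and> a < nletters A \<and> d \<in> {-1, 0, 1} \<and> q' < nstates A)"

type_synonym config = "nat \<times> nat"

definition avail :: "oca \<Rightarrow> config \<Rightarrow> nat \<Rightarrow> trans \<Rightarrow> bool" where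
  "avail A c a t \<longleftrightarrow> t \<in> set (delta A) \<and>
     (case t of (q, z, b, d, q') \<Rightarrow> q = fst c \<and> b = a \<and>
        ((snd c > 0 \<and> \<not> z) \<or> (snd c = 0 \<and> z \<and> d \<in> {0, 1})))"

definition apply_trans :: "trans \<Rightarrow> config \<Rightarrow> config" where
  "apply_trans t c = (case t of (q, z, b, d, q') \<Rightarrow> (q', nat (int (snd c) + d)))"

inductive reach :: "oca \<Rightarrow> config \<Rightarrow> nat list \<Rightarrow> config \<Rightarrow> bool" for A where
  reach_nil: "reach A c [] c"
| reach_cons: "avail A c a t \<Longrightarrow> reach A (apply_trans t c) w c' \<Longrightarrow> reach A c (a # w) c'"

definition lang :: "oca \<Rightarrow> nat list set" where
  "lang A = {w. \<exists>c. reach A (init A, 0) w c \<and> fst c \<in> set (final A)}"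

definition prefixes_lang :: "oca \<Rightarrow> nat list set" where
  "prefixes_lang A = {w. \<exists>v. w @ v \<in> lang A}"

text \<open>A strategy of Eve maps the word played so far and Adam's new letter to a transition.
(Eve's own earlier moves are determined by the strategy and the word.)\<close>
type_synonym strategy = "nat list \<Rightarrow> nat \<Rightarrow> trans"

fun play_conf :: "oca \<Rightarrow> strategy \<Rightarrow> config \<Rightarrow> nat list \<Rightarrow> nat list \<Rightarrow> config" where
  "play_conf A \<sigma> c u [] = c"
| "play_conf A \<sigma> c u (a # v) = play_conf A \<sigma> (apply_trans (\<sigma> u a) c) (u @ [a]) v"

definition conf :: "oca \<Rightarrow> strategy \<Rightarrow> nat list \<Rightarrow> config" where
  "conf A \<sigma> w = play_conf A \<sigma> (init A, 0) [] w"

inductive reached :: "oca \<Rightarrow> strategy \<Rightarrow> nat list \<Rightarrow> bool" for A \<sigma> where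
  reached_nil: "reached A \<sigma> []"
| reached_snoc: "reached A \<sigma> w \<Longrightarrow> a < nletters A \<Longrightarrow> avail A (conf A \<sigma> w) a (\<sigma> w a)
     \<Longrightarrow> reached A \<sigma> (w @ [a])"

text \<open>\<sigma> is winning: in every reached round and for every letter of Adam,
 - if some transition is available, \<sigma> picks an available one (legality);
 - if none is available, w a is not a prefix of a word of the language (else Eve loses);
 - if \<sigma> moves and w a is in the language, the new state is final (else Adam wins).
Plays that never end, and plays ending with Eve stuck outside the prefixes of the
language, are won by Eve.\<close>
definition eve_winning :: "oca \<Rightarrow> strategy \<Rightarrow> bool" where
  "eve_winning A \<sigma> \<longleftrightarrow> (\<forall>w a. reached A \<sigma> w \<and> a < nletters A \<longrightarrow>
      ((\<exists>t. avail A (conf A \<sigma> w) a t) \<longrightarrow> avail A (conf A \<sigma> w) a (\<sigma> w a)) \<and>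
      (\<not> (\<exists>t. avail A (conf A \<sigma> w) a t) \<longrightarrow> w @ [a] \<notin> prefixes_lang A) \<and>
      (avail A (conf A \<sigma> w) a (\<sigma> w a) \<and> w @ [a] \<in> lang A \<longrightarrow>
         fst (apply_trans (\<sigma> w a) (conf A \<sigma> w)) \<in> set (final A)))"

definition history_deterministic :: "oca \<Rightarrow> bool" where
  "history_deterministic A \<longleftrightarrow> (\<exists>\<sigma>. eve_winning A \<sigma>)"

datatype recf = Z | S | Id nat | Cn recf "recf list" | Pr recf recf | Mn recf

inductive rec_eval :: "recf \<Rightarrow> nat list \<Rightarrow> nat \<Rightarrow> bool" where
  ev_Z: "rec_eval Z xs 0"
| ev_S: "rec_eval S (x # xs) (Suc x)"
| ev_Id: "i < length xs \<Longrightarrow> rec_eval (Id i) xs (xs ! i)"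
| ev_Cn: "list_all2 (\<lambda>g y. rec_eval g xs y) gs ys \<Longrightarrow> rec_eval f ys z \<Longrightarrow> rec_eval (Cn f gs) xs z"
| ev_Pr0: "rec_eval g xs z \<Longrightarrow> rec_eval (Pr g h) (0 # xs) z"
| ev_PrS: "rec_eval (Pr g h) (n # xs) y \<Longrightarrow> rec_eval h (n # y # xs) z \<Longrightarrow> rec_eval (Pr g h) (Suc n # xs) z"
| ev_Mn: "rec_eval f (n # xs) 0 \<Longrightarrow> (\<forall>i<n. \<exists>y>0. rec_eval f (i # xs) y) \<Longrightarrow> rec_eval (Mn f) xs n"

definition encode_trans :: "trans \<Rightarrow> nat" where
  "encode_trans t = (case t of (q, z, a, d, q') \<Rightarrow>
     list_encode [q, of_bool z, a, int_encode d, q'])"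

definition encode_oca :: "oca \<Rightarrow> nat" where
  "encode_oca A = list_encode [nstates A, nletters A, list_encode (map encode_trans (delta A)),
     init A, list_encode (final A)]"

definition oca_problem_decidable :: "(oca \<Rightarrow> bool) \<Rightarrow> bool" where
  "oca_problem_decidable P \<longleftrightarrow> (\<exists>f. \<forall>A. oca_wf A \<longrightarrow>
     rec_eval f [encode_oca A] (if P A then 1 else 0))"

end

theory Submission
  imports Defs "HOL-Computational_Algebra.Primes"
begin

text \<open>
  From a two-counter machine \<open>P\<close> and a number \<open>n\<close> we build an automaton that first loads \<open>n\<close> into its
  counter. Then Eve chooses between two deterministic components, each of which
  stores one counter of \<open>P\<close> while Adam spells out the outcomes of the zero tests. The first
  component accepts if \<open>P\<close> halts and all claims about the first counter are true; the
  second one accepts as soon as a claim about the second counter is false. If \<open>P\<close> does not halt from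
  \<open>(n, n)\<close>, the second component accepts every word that the first one accepts, so choosing it wins.
  If \<open>P\<close> halts, Adam refutes the second component with the halting run, and the first one with a false
  claim about the second counter.

  Undecidability follows by diagonalization. A decider \<open>f\<close> is turned into a machine \<open>P\<close> whose
  first counter contains a Goedel number; started with \<open>2 ^ x\<close>, it halts iff \<open>f\<close> answers yes on the
  automaton whose machine part has code \<open>x\<close> and which loads \<open>2 ^ x\<close>. For \<open>x\<close>
  take the code of the machine part of \<open>P\<close> itself. Only the forward simulation of terminating
  computations is needed, as \<open>f\<close> is total on codes of automata.
\<close>

section \<open>Loop programs for recursive functions\<close>

datatype com = Skip | Incr nat | Seq com com | Loop nat com

text \<open>Each pass of a loop first takes one from the loop register, which the body may raise
  again. Loops therefore need not terminate, as unbounded search for \<open>Mn\<close>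
  requires.\<close>

inductive exec :: "com \<Rightarrow> (nat \<Rightarrow> nat) \<Rightarrow> (nat \<Rightarrow> nat) \<Rightarrow> bool" where
  exec_Skip: "exec Skip s s"
| exec_Incr: "exec (Incr r) s (s(r := Suc (s r)))"
| exec_Seq: "exec c s t \<Longrightarrow> exec c' t u \<Longrightarrow> exec (Seq c c') s u"
| exec_Loop0: "s r = 0 \<Longrightarrow> exec (Loop r c) s s"
| exec_LoopS: "s r = Suc m \<Longrightarrow> exec c (s(r := m)) t \<Longrightarrow> exec (Loop r c) t u \<Longrightarrow> exec (Loop r c) s u"

section \<open>Clearing, moving and copying registers\<close>

lemma exec_clear: "exec (Loop r Skip) s (s(r := 0))"
proof (induction "s r" arbitrary: s)
  case 0
  then have "s(r := 0) = s" by auto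
  then show ?case using 0 by (metis exec_Loop0)
next
  case (Suc m)
  have "exec (Loop r Skip) (s(r := m)) (s(r := 0))"
    using Suc(1)[of "s(r := m)"] by simp
  with Suc(2)[symmetric] exec_Skip show ?case by (rule exec_LoopS)
qed

lemma exec_move: "a \<noteq> b \<Longrightarrow> exec (Loop a (Incr b)) s (s(a := 0, b := s b + s a))"
proof (induction "s a" arbitrary: s)
  case 0
  then have "s(a := 0, b := s b + s a) = s" by auto
  then show ?case using 0 by (metis exec_Loop0)
next
  case (Suc m)
  let ?t = "s(a := m, b := Suc (s b))"
  have 1: "exec (Incr b) (s(a := m)) ?t"
    using exec_Incr[of b "s(a := m)"] Suc(3) by simp
  have "exec (Loop a (Incr b)) ?t (?t(a := 0, b := ?t b + ?t a))"
    using Suc(1)[of ?t] Suc(3) by simp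
  moreover have "?t(a := 0, b := ?t b + ?t a) = s(a := 0, b := s b + s a)"
    using Suc(2,3) by (auto simp: fun_eq_iff)
  ultimately show ?case using exec_LoopS[OF Suc(2)[symmetric] 1] by simp
qed

lemma exec_move2:
  "a \<noteq> b \<Longrightarrow> a \<noteq> k \<Longrightarrow> b \<noteq> k \<Longrightarrow>
   exec (Loop a (Seq (Incr b) (Incr k))) s (s(a := 0, b := s b + s a, k := s k + s a))"
proof (induction "s a" arbitrary: s)
  case 0
  then have "s(a := 0, b := s b + s a, k := s k + s a) = s" by auto
  then show ?case using 0 by (metis exec_Loop0)
next
  case (Suc m)
  let ?t = "s(a := m, b := Suc (s b), k := Suc (s k))"
  have 1: "exec (Seq (Incr b) (Incr k)) (s(a := m)) ?t"
    using exec_Seq[OF exec_Incr[of b "s(a := m)"] exec_Incr[of k]] Suc(3-5) by simp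
  have "exec (Loop a (Seq (Incr b) (Incr k))) ?t (?t(a := 0, b := ?t b + ?t a, k := ?t k + ?t a))"
    using Suc(1)[of ?t] Suc(3-5) by simp
  moreover have "?t(a := 0, b := ?t b + ?t a, k := ?t k + ?t a)
      = s(a := 0, b := s b + s a, k := s k + s a)"
    using Suc(2-5) by (auto simp: fun_eq_iff)
  ultimately show ?case using exec_LoopS[OF Suc(2)[symmetric] 1] by simp
qed

text \<open>Reading \<open>a\<close> empties it, so the scratch register \<open>k\<close> takes a
  second copy from which \<open>a\<close> is refilled.\<close>

definition copy :: "nat \<Rightarrow> nat \<Rightarrow> nat \<Rightarrow> com" where
  "copy a b k = Seq (Loop a (Seq (Incr b) (Incr k))) (Loop k (Incr a))"

lemma exec_copy:
  assumes "a \<noteq> b" "a \<noteq> k" "b \<noteq> k" "s k = 0"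
  shows "exec (copy a b k) s (s(b := s b + s a))"
proof -
  let ?t = "s(a := 0, b := s b + s a, k := s k + s a)"
  have "exec (copy a b k) s (?t(k := 0, a := ?t a + ?t k))"
    unfolding copy_def
    using exec_Seq[OF exec_move2[OF assms(1-3)] exec_move[of k a ?t]] assms(2) by simp
  moreover have "?t(k := 0, a := ?t a + ?t k) = s(b := s b + s a)"
    using assms by (auto simp: fun_eq_iff)
  ultimately show ?thesis by simp
qed

lemma exec_clear_range:
  "\<exists>c. \<forall>s. exec c s (\<lambda>r. if k \<le> r \<and> r < k + m then 0 else s r)"
proof (induction m)
  case 0
  have "(\<lambda>r. if k \<le> r \<and> r < k + 0 then 0 else s r) = s" for s :: "nat \<Rightarrow> nat"
    by (auto simp: fun_eq_iff)
  then show ?case using exec_Skip by metis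
next
  case (Suc m)
  then obtain c where c: "\<And>s. exec c s (\<lambda>r. if k \<le> r \<and> r < k + m then 0 else s r)" by blast
  have "exec (Seq c (Loop (k + m) Skip)) s (\<lambda>r. if k \<le> r \<and> r < k + Suc m then 0 else s r)" for s
  proof -
    have "(\<lambda>r. if k \<le> r \<and> r < k + m then 0 else s r)(k + m := 0)
      = (\<lambda>r. if k \<le> r \<and> r < k + Suc m then 0 else s r)" by (auto simp: fun_eq_iff)
    then show ?thesis using exec_Seq[OF c exec_clear] by metis
  qed
  then show ?case by blast
qed

section \<open>Compilation of recursive functions\<close>

text \<open>Registers from \<open>k\<close> on are zeroed scratch space, which is restored on exit.\<close>

definition implements :: "com \<Rightarrow> recf \<Rightarrow> nat list \<Rightarrow> nat \<Rightarrow> nat \<Rightarrow> bool" where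
  "implements c f as d k \<longleftrightarrow> (\<forall>s y. (\<forall>r\<ge>k. s r = 0) \<longrightarrow> s d = 0 \<longrightarrow>
     rec_eval f (map s as) y \<longrightarrow> exec c s (s(d := y)))"

text \<open>Argument registers, destination and start of the scratch space are all arbitrary, so
  that the induction hypotheses fit any register layout that a calling function chooses.\<close>

definition compilable :: "recf \<Rightarrow> bool" where
  "compilable f \<longleftrightarrow> (\<forall>as d k. (\<forall>a\<in>set as. a < k) \<longrightarrow> d < k \<longrightarrow> d \<notin> set as \<longrightarrow>
     (\<exists>c. implements c f as d k))"

lemma compilableD:
  "compilable f \<Longrightarrow> \<forall>a\<in>set as. a < k \<Longrightarrow> d < k \<Longrightarrow> d \<notin> set as \<Longrightarrow>
    \<exists>c. implements c f as d k"
  unfolding compilable_def by blast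

lemma implementsD:
  "implements c f as d k \<Longrightarrow> \<forall>r\<ge>k. s r = 0 \<Longrightarrow> s d = 0 \<Longrightarrow> rec_eval f (map s as) y \<Longrightarrow>
    exec c s (s(d := y))"
  unfolding implements_def by blast

text \<open>In a composition this is the state after the inner functions have left their values in
  consecutive scratch registers.\<close>

definition overlay :: "(nat \<Rightarrow> nat) \<Rightarrow> nat \<Rightarrow> nat list \<Rightarrow> nat \<Rightarrow> nat" where
  "overlay s k ys r = (if k \<le> r \<and> r < k + length ys then ys ! (r - k) else s r)"

lemma overlay_Nil: "overlay s k [] = s"
  by (auto simp: fun_eq_iff overlay_def)

lemma overlay_Cons: "overlay (s(k := y)) (Suc k) ys = overlay s k (y # ys)"
  by (auto simp: fun_eq_iff overlay_def nth_Cons' Suc_diff_Suc)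

lemma map_overlay: "map (overlay s k ys) [k..<k + length ys] = ys"
  by (rule nth_equalityI) (auto simp: overlay_def)

text \<open>The functions are evaluated one after the other. Their private scratch space starts at
  \<open>m\<close>, beyond all result registers, and \<open>k \<le> d\<close> keeps the results away
  from the arguments.\<close>

lemma compile_list:
  assumes "\<forall>g\<in>set gs. compilable g" "\<forall>a\<in>set as. a < k" "k \<le> d" "d + length gs \<le> m"
  shows "\<exists>c. \<forall>s ys. (\<forall>r\<ge>d. s r = 0) \<longrightarrow> list_all2 (\<lambda>g y. rec_eval g (map s as) y) gs ys \<longrightarrow>
    exec c s (overlay s d ys)"
  using assms
proof (induction gs arbitrary: d)
  case Nil
  then show ?case by (auto simp: overlay_Nil intro!: exI[of _ Skip] exec_Skip)
next
  case (Cons g gs)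
  have "\<exists>c. \<forall>s ys. (\<forall>r\<ge>Suc d. s r = 0) \<longrightarrow> list_all2 (\<lambda>g y. rec_eval g (map s as) y) gs ys \<longrightarrow>
    exec c s (overlay s (Suc d) ys)"
    using Cons.prems by (intro Cons.IH) auto
  then obtain c where c: "\<And>s ys. \<forall>r\<ge>Suc d. s r = 0 \<Longrightarrow>
    list_all2 (\<lambda>g y. rec_eval g (map s as) y) gs ys \<Longrightarrow> exec c s (overlay s (Suc d) ys)"
    by blast
  have "\<exists>c. implements c g as d m"
    using Cons.prems by (intro compilableD) auto
  then obtain c' where c': "implements c' g as d m" by blast
  have "exec (Seq c' c) s (overlay s d ys)"
    if s: "\<forall>r\<ge>d. s r = 0" and ys: "list_all2 (\<lambda>g y. rec_eval g (map s as) y) (g # gs) ys" for s ys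
  proof -
    obtain y ys' where y: "ys = y # ys'" "rec_eval g (map s as) y"
      "list_all2 (\<lambda>g y. rec_eval g (map s as) y) gs ys'"
      using ys by (auto simp: list_all2_Cons1)
    have 1: "exec c' s (s(d := y))"
      using s y(2) Cons.prems(4) by (intro implementsD[OF c']) auto
    have m: "map (s(d := y)) as = map s as"
      using Cons.prems by auto
    have 2: "exec c (s(d := y)) (overlay (s(d := y)) (Suc d) ys')"
      using s y(3) by (intro c) (auto simp: m simp del: map_eq_conv)
    show ?thesis
      using exec_Seq[OF 1 2] by (simp add: overlay_Cons y(1))
  qed
  then show ?case by blast
qed

text \<open>The sequence \<open>v\<close> of intermediate values serves as the invariant of the
  compiled loop.\<close>

lemma rec_eval_Pr_values:
  "rec_eval (Pr g h) (n # xs) z \<Longrightarrow>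
   \<exists>v. rec_eval g xs (v 0) \<and> (\<forall>i<n. rec_eval h (i # v i # xs) (v (Suc i))) \<and> v n = z"
proof (induction n arbitrary: z)
  case 0
  then show ?case by (auto elim: rec_eval.cases intro: exI[of _ "\<lambda>_. z"])
next
  case (Suc n)
  from Suc.prems obtain y where y: "rec_eval (Pr g h) (n # xs) y" "rec_eval h (n # y # xs) z"
    by (auto elim: rec_eval.cases)
  from Suc.IH[OF y(1)] obtain v where
    v: "rec_eval g xs (v 0)" "\<forall>i<n. rec_eval h (i # v i # xs) (v (Suc i))" "v n = y" by blast
  have "\<forall>i<Suc n. rec_eval h (i # (v(Suc n := z)) i # xs) ((v(Suc n := z)) (Suc i))"
    using v y by (auto simp: less_Suc_eq)
  then show ?case using v by (intro exI[of _ "v(Suc n := z)"]) auto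
qed

lemma compilable_Cn:
  assumes f: "compilable f" and gs: "\<forall>g\<in>set gs. compilable g"
  shows "compilable (Cn f gs)"
  unfolding compilable_def
proof (intro allI impI)
  fix as d k assume as: "\<forall>a\<in>set as. a < k" and d: "d < (k::nat)" "d \<notin> set as"
  let ?m = "k + length gs"
  from compile_list[OF gs as order_refl order_refl]
  obtain c1 where c1: "\<And>s ys. \<forall>r\<ge>k. s r = 0 \<Longrightarrow>
    list_all2 (\<lambda>g y. rec_eval g (map s as) y) gs ys \<Longrightarrow> exec c1 s (overlay s k ys)" by blast
  have "\<exists>c. implements c f [k..<?m] d ?m"
    using d by (intro compilableD[OF f]) auto
  then obtain c2 where c2: "implements c2 f [k..<?m] d ?m" by blast
  obtain c3 where c3: "\<And>s. exec c3 s (\<lambda>r. if k \<le> r \<and> r < ?m then 0 else s r)"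
    using exec_clear_range by blast
  have "exec (Seq c1 (Seq c2 c3)) s (s(d := z))"
    if s: "\<forall>r\<ge>k. s r = 0" "s d = 0" and z: "rec_eval (Cn f gs) (map s as) z" for s z
  proof -
    from z obtain ys where ys: "list_all2 (\<lambda>g y. rec_eval g (map s as) y) gs ys" "rec_eval f ys z"
      by (auto elim: rec_eval.cases)
    have len: "length ys = length gs" using ys(1) by (simp add: list_all2_lengthD)
    let ?t = "overlay s k ys"
    have 1: "exec c1 s ?t" using c1 s ys by blast
    have 2: "exec c2 ?t (?t(d := z))"
      using s d ys(2) map_overlay[of s k ys]
      by (intro implementsD[OF c2]) (auto simp: len, auto simp: overlay_def len)
    have "(\<lambda>r. if k \<le> r \<and> r < ?m then 0 else (?t(d := z)) r) = s(d := z)"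
      using s d by (auto simp: fun_eq_iff overlay_def len)
    then have "exec c3 (?t(d := z)) (s(d := z))" using c3 by metis
    then show ?thesis using 1 2 by (blast intro: exec_Seq)
  qed
  then show "\<exists>c. implements c (Cn f gs) as d k" unfolding implements_def by blast
qed

lemma compilable_Pr:
  assumes g: "compilable g" and h: "compilable h"
  shows "compilable (Pr g h)"
  unfolding compilable_def
proof (intro allI impI)
  fix as d k assume as: "\<forall>a\<in>set as. a < k" and d: "d < (k::nat)" "d \<notin> set as"
  show "\<exists>c. implements c (Pr g h) as d k"
  proof (cases as)
    case Nil
    \<comment> \<open>\<open>Pr\<close> has no value on an empty argument list.\<close>
    then show ?thesis by (auto simp: implements_def elim: rec_eval.cases)
  next
    case (Cons a as')
    \<comment> \<open>Register \<open>k\<close> counts the remaining passes, \<open>k + 1\<close> is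
      the recursion index, \<open>k + 2\<close> the current value and \<open>k + 3\<close> the next
      one; scratch space for the calls starts at \<open>k + 4\<close>.\<close>
    let ?b = "k + 4"
    have "\<exists>c. implements c g as' (k + 2) ?b"
      using as Cons by (intro compilableD[OF g]) auto
    then obtain cg where cg: "implements cg g as' (k + 2) ?b" by blast
    have "\<exists>c. implements c h ((k + 1) # (k + 2) # as') (k + 3) ?b"
      using as Cons by (intro compilableD[OF h]) auto
    then obtain ch where ch: "implements ch h ((k + 1) # (k + 2) # as') (k + 3) ?b" by blast
    let ?body = "Seq ch (Seq (Loop (k + 2) Skip) (Seq (Loop (k + 3) (Incr (k + 2))) (Incr (k + 1))))"
    let ?c = "Seq (copy a k ?b) (Seq cg (Seq (Loop k ?body)
      (Seq (Loop (k + 2) (Incr d)) (Loop (k + 1) Skip))))"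
    have "exec ?c s (s(d := z))"
      if s: "\<forall>r\<ge>k. s r = 0" "s d = 0" and z: "rec_eval (Pr g h) (map s as) z" for s z
    proof -
      let ?xs = "map s as'"
      have m: "map (s(k := j, k + 1 := i, k + 2 := y)) as' = ?xs" for j i y
        using as Cons by auto
      from z Cons have "rec_eval (Pr g h) (s a # ?xs) z" by simp
      from rec_eval_Pr_values[OF this] obtain v where
        v: "rec_eval g ?xs (v 0)" "\<And>i. i < s a \<Longrightarrow> rec_eval h (i # v i # ?xs) (v (Suc i))"
        "v (s a) = z" by blast
      let ?st = "\<lambda>j i y. s(k := j, k + 1 := i, k + 2 := y)"
      have 1: "exec (copy a k ?b) s (?st (s a) 0 0)"
      proof -
        have "exec (copy a k ?b) s (s(k := s k + s a))"
          using as Cons s by (intro exec_copy) auto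
        moreover have "s(k := s k + s a) = ?st (s a) 0 0"
          using s by (auto simp: fun_eq_iff)
        ultimately show ?thesis by simp
      qed
      have 2: "exec cg (?st (s a) 0 0) (?st (s a) 0 (v 0))"
      proof -
        have "rec_eval g (map (?st (s a) 0 0) as') (v 0)" unfolding m by (rule v(1))
        then have "exec cg (?st (s a) 0 0) ((?st (s a) 0 0)(k + 2 := v 0))"
          using s by (intro implementsD[OF cg]) simp_all
        then show ?thesis by simp
      qed
      have body: "exec ?body (?st j i (v i)) (?st j (Suc i) (v (Suc i)))" if "i < s a" for i j
      proof -
        let ?y = "v (Suc i)"
        let ?t = "?st j i (v i)"
        have e: "rec_eval h (map ?t ((k + 1) # (k + 2) # as')) ?y"
          unfolding list.map m using v(2)[OF that] by simp
        have a: "exec ch ?t (?t(k + 3 := ?y))"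
          using s e by (intro implementsD[OF ch]) simp_all
        have "exec ?body ?t (?t(k + 3 := ?y, k + 2 := 0, k + 3 := 0, k + 2 := ?y, k + 1 := Suc i))"
        proof (rule exec_Seq[OF a exec_Seq[OF exec_clear exec_Seq]])
          show "exec (Loop (k + 3) (Incr (k + 2))) (?t(k + 3 := ?y, k + 2 := 0))
            (?t(k + 3 := ?y, k + 2 := 0, k + 3 := 0, k + 2 := ?y))"
            using exec_move[of "k + 3" "k + 2" "?t(k + 3 := ?y, k + 2 := 0)"] by simp
          show "exec (Incr (k + 1)) (?t(k + 3 := ?y, k + 2 := 0, k + 3 := 0, k + 2 := ?y))
            (?t(k + 3 := ?y, k + 2 := 0, k + 3 := 0, k + 2 := ?y, k + 1 := Suc i))"
            using exec_Incr[of "k + 1" "?t(k + 3 := ?y, k + 2 := 0, k + 3 := 0, k + 2 := ?y)"]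
            by simp
        qed
        moreover have "?t(k + 3 := ?y, k + 2 := 0, k + 3 := 0, k + 2 := ?y, k + 1 := Suc i)
          = ?st j (Suc i) ?y"
          using s by (auto simp: fun_eq_iff)
        ultimately show ?thesis by simp
      qed
      have loop: "exec (Loop k ?body) (?st j i (v i)) (?st 0 (s a) z)" if "i + j = s a" for i j
        using that
      proof (induction j arbitrary: i)
        case 0
        then show ?case using v(3) by (auto intro!: exec_Loop0)
      next
        case (Suc j)
        have b: "exec ?body ((?st (Suc j) i (v i))(k := j)) (?st j (Suc i) (v (Suc i)))"
        proof -
          have "(?st (Suc j) i (v i))(k := j) = ?st j i (v i)" by (auto simp: fun_eq_iff)
          then show ?thesis using body[of i j] Suc.prems by simp
        qed
        have l: "exec (Loop k ?body) (?st j (Suc i) (v (Suc i))) (?st 0 (s a) z)"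
          using Suc.prems by (intro Suc.IH) simp
        show ?case by (rule exec_LoopS[OF _ b l]) simp
      qed
      let ?u = "?st 0 (s a) z"
      have fin: "exec (Seq (Loop (k + 2) (Incr d)) (Loop (k + 1) Skip)) ?u (s(d := z))"
      proof -
        have "exec (Seq (Loop (k + 2) (Incr d)) (Loop (k + 1) Skip)) ?u
          (?u(k + 2 := 0, d := ?u d + ?u (k + 2), k + 1 := 0))"
          using d by (intro exec_Seq[OF exec_move exec_clear]) auto
        moreover have "?u(k + 2 := 0, d := ?u d + ?u (k + 2), k + 1 := 0) = s(d := z)"
          using s d by (auto simp: fun_eq_iff)
        ultimately show ?thesis by simp
      qed
      show ?thesis
        by (rule exec_Seq[OF 1 exec_Seq[OF 2 exec_Seq[OF loop fin]]]) simp
    qed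
    then show ?thesis unfolding implements_def by blast
  qed
qed

lemma compilable_Mn:
  assumes f: "compilable f"
  shows "compilable (Mn f)"
  unfolding compilable_def
proof (intro allI impI)
  fix as d k assume as: "\<forall>a\<in>set as. a < k" and d: "d < (k::nat)" "d \<notin> set as"
  have "\<exists>c. implements c f (k # as) (k + 1) (k + 2)"
    using as by (intro compilableD[OF f]) auto
  then obtain c where c: "implements c f (k # as) (k + 1) (k + 2)" by blast
  \<comment> \<open>Register \<open>k\<close> holds the candidate and \<open>k + 1\<close> the value
    of \<open>f\<close> there; the loop runs as long as that value is positive.\<close>
  let ?body = "Seq (Loop (k + 1) Skip) (Seq (Incr k) c)"
  let ?c = "Seq c (Seq (Loop (k + 1) ?body) (Loop k (Incr d)))"
  have "exec ?c s (s(d := n))"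
    if s: "\<forall>r\<ge>k. s r = 0" "s d = 0" and z: "rec_eval (Mn f) (map s as) n" for s n
  proof -
    let ?xs = "map s as"
    from z have z0: "rec_eval f (n # ?xs) 0" and "\<forall>i<n. \<exists>y>0. rec_eval f (i # ?xs) y"
      by (auto elim: rec_eval.cases)
    then obtain v where v: "\<And>i. i < n \<Longrightarrow> 0 < v i \<and> rec_eval f (i # ?xs) (v i)" by metis
    \<comment> \<open>One sequence combines the positive values below \<open>n\<close> with the
      value 0 at \<open>n\<close>, which ends the loop.\<close>
    define w where "w i = (if i < n then v i else 0)" for i
    have w: "rec_eval f (i # ?xs) (w i)" if "i \<le> n" for i
      using that z0 v by (auto simp: w_def not_less)
    let ?st = "\<lambda>i y. s(k := i, k + 1 := y)"
    have call: "exec c (?st i 0) (?st i (w i))" if "i \<le> n" for i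
    proof -
      have m: "map (?st i 0) as = ?xs" using as by auto
      have "rec_eval f (map (?st i 0) (k # as)) (w i)"
        unfolding list.map m using w[OF that] by simp
      then have "exec c (?st i 0) ((?st i 0)(k + 1 := w i))"
        using s by (intro implementsD[OF c]) simp_all
      then show ?thesis by simp
    qed
    have body: "exec ?body (?st i y) (?st (Suc i) (w (Suc i)))" if "i < n" for i y
    proof -
      have "exec (Loop (k + 1) Skip) (?st i y) (?st i 0)"
        using exec_clear[of "k + 1" "?st i y"] by simp
      moreover have "exec (Incr k) (?st i 0) (?st (Suc i) 0)"
        using exec_Incr[of k "?st i 0"] by (simp add: fun_upd_twist)
      moreover have "exec c (?st (Suc i) 0) (?st (Suc i) (w (Suc i)))"
        using call that by simp
      ultimately show ?thesis by (blast intro: exec_Seq)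
    qed
    have loop: "exec (Loop (k + 1) ?body) (?st i (w i)) (?st n 0)" if "i + j = n" for i j
      using that
    proof (induction j arbitrary: i)
      case 0
      then show ?case by (auto intro!: exec_Loop0 simp: w_def)
    next
      case (Suc j)
      then have "w i > 0" using v by (simp add: w_def)
      then obtain y where y: "w i = Suc y" by (cases "w i") auto
      have b: "exec ?body ((?st i (w i))(k + 1 := y)) (?st (Suc i) (w (Suc i)))"
        using body[of i y] Suc.prems by simp
      have l: "exec (Loop (k + 1) ?body) (?st (Suc i) (w (Suc i))) (?st n 0)"
        using Suc.prems by (intro Suc.IH) simp
      show ?case by (rule exec_LoopS[OF _ b l]) (simp add: y)
    qed
    have 1: "exec c s (?st 0 (w 0))"
    proof -
      have "?st 0 0 = s" using s by (auto simp: fun_eq_iff)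
      then show ?thesis using call[of 0] by simp
    qed
    have fin: "exec (Loop k (Incr d)) (?st n 0) (s(d := n))"
    proof -
      let ?u = "?st n 0"
      have "exec (Loop k (Incr d)) ?u (?u(k := 0, d := ?u d + ?u k))"
        using d by (intro exec_move) auto
      moreover have "?u(k := 0, d := ?u d + ?u k) = s(d := n)"
        using s d by (auto simp: fun_eq_iff)
      ultimately show ?thesis by simp
    qed
    show ?thesis by (rule exec_Seq[OF 1 exec_Seq[OF loop fin]]) simp
  qed
  then show "\<exists>c. implements c (Mn f) as d k" unfolding implements_def by blast
qed

theorem recf_compilable: "compilable f"
proof (induction f)
  case Z
  have "exec Skip s (s(d := y))" if "s d = 0" "rec_eval Z (map s as) y" for s d y as
  proof -
    have "y = 0" using that(2) by cases simp
    then have "s(d := y) = s" using that(1) by auto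
    then show ?thesis using exec_Skip by metis
  qed
  then show ?case unfolding compilable_def implements_def by blast
next
  case S
  show ?case unfolding compilable_def
  proof (intro allI impI)
    fix as d k assume as: "\<forall>a\<in>set as. a < k" and d: "d < (k::nat)" "d \<notin> set as"
    have "exec (Seq (copy (hd as) d k) (Incr d)) s (s(d := y))"
      if s: "\<forall>r\<ge>k. s r = 0" "s d = 0" and y: "rec_eval S (map s as) y" for s y
    proof -
      from y obtain a as' where a: "as = a # as'" "y = Suc (s a)"
        by (auto elim: rec_eval.cases)
      have "exec (copy a d k) s (s(d := s d + s a))"
        using as d s a by (intro exec_copy) auto
      from exec_Seq[OF this exec_Incr[of d]] show ?thesis using s a by simp
    qed
    then show "\<exists>c. implements c S as d k" unfolding implements_def by blast
  qed
next
  case (Id i)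
  show ?case unfolding compilable_def
  proof (intro allI impI)
    fix as d k assume as: "\<forall>a\<in>set as. a < k" and d: "d < (k::nat)" "d \<notin> set as"
    have "exec (copy (as ! i) d k) s (s(d := y))"
      if s: "\<forall>r\<ge>k. s r = 0" "s d = 0" and y: "rec_eval (Id i) (map s as) y" for s y
    proof -
      from y have i: "i < length as" "y = s (as ! i)" by (auto elim: rec_eval.cases)
      then have "as ! i \<in> set as" by simp
      then have "exec (copy (as ! i) d k) s (s(d := s d + s (as ! i)))"
        using as d s by (intro exec_copy) auto
      then show ?thesis using s i by simp
    qed
    then show "\<exists>c. implements c (Id i) as d k" unfolding implements_def by blast
  qed
qed (auto intro: compilable_Cn compilable_Pr compilable_Mn)

section \<open>Two-counter machines as one-counter automata\<close>

lemma reach_Nil_iff: "reach A c [] d \<longleftrightarrow> d = c"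
  by (subst reach.simps) auto

lemma reach_Cons_iff:
  "reach A c (a # w) d \<longleftrightarrow> (\<exists>t. avail A c a t \<and> reach A (apply_trans t c) w d)"
  by (subst reach.simps) blast

lemma reach_append:
  "reach A c (u @ v) c' \<longleftrightarrow> (\<exists>d. reach A c u d \<and> reach A d v c')"
  by (induction u arbitrary: c) (simp add: reach_Nil_iff, simp add: reach_Cons_iff, blast)

lemma reach_snoc: "reach A c w d \<Longrightarrow> avail A d a t \<Longrightarrow> reach A c (w @ [a]) (apply_trans t d)"
  unfolding reach_append by (blast intro: reach_nil reach_cons)

lemma play_conf_snoc:
  "play_conf A \<sigma> c u (v @ [a]) = apply_trans (\<sigma> (u @ v) a) (play_conf A \<sigma> c u v)"
  by (induction v arbitrary: c u) auto

lemma conf_Nil: "conf A \<sigma> [] = (init A, 0)"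
  by (simp add: conf_def)

lemma conf_snoc: "conf A \<sigma> (w @ [a]) = apply_trans (\<sigma> w a) (conf A \<sigma> w)"
  by (simp add: conf_def play_conf_snoc)

text \<open>Playing by \<open>pick\<close> keeps Eve's configuration related to every configuration
  that some run reaches on the same word. Hence Eve is stuck only if all runs are, and is in a final
  state whenever some run is.\<close>

lemma history_deterministic_by_simulation:
  assumes init: "R (init A, 0) (init A, 0)"
    and sim: "\<And>c e a t. R c e \<Longrightarrow> avail A c a t \<Longrightarrow>
      avail A e a (pick e a) \<and> R (apply_trans t c) (apply_trans (pick e a) e)"
    and fin: "\<And>c e. R c e \<Longrightarrow> fst c \<in> set (final A) \<Longrightarrow> fst e \<in> set (final A)"
  shows "history_deterministic A"
proof -
  \<comment> \<open>\<open>pick\<close> is constrained on related pairs only; the fallback keeps the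
    strategy legal wherever some transition is available.\<close>
  define pick' where "pick' e a = (if avail A e a (pick e a) then pick e a else SOME t. avail A e a t)" for e a
  define D where "D = foldl (\<lambda>e a. apply_trans (pick' e a) e) (init A, 0)"
  define \<sigma> where "\<sigma> w a = pick' (D w) a" for w a
  have conf: "conf A \<sigma> w = D w" for w
    by (induction w rule: rev_induct) (simp_all add: conf_Nil conf_snoc D_def \<sigma>_def)
  have legal: "avail A e a (pick' e a)" if "avail A e a t" for e a t
    using that unfolding pick'_def by (auto intro: someI)
  have sim': "avail A e a (pick' e a) \<and> R (apply_trans t c) (apply_trans (pick' e a) e)"
    if "R c e" "avail A c a t" for c e a t
    using sim[OF that] by (simp add: pick'_def)
  have track: "R c (D w)" if "reach A (init A, 0) w c" for w c
    using that
  proof (induction w arbitrary: c rule: rev_induct)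
    case Nil
    then show ?case by (simp add: D_def init reach_Nil_iff)
  next
    case (snoc a w)
    then obtain d t where "reach A (init A, 0) w d" "avail A d a t" "c = apply_trans t d"
      unfolding reach_append reach_Cons_iff reach_Nil_iff by blast
    then show ?case using snoc.IH sim' by (simp add: D_def)
  qed
  have "eve_winning A \<sigma>"
    unfolding eve_winning_def conf
  proof (intro allI impI conjI)
    fix w a
    show "avail A (D w) a (\<sigma> w a)" if "\<exists>t. avail A (D w) a t"
      using that legal unfolding \<sigma>_def by blast
    show "w @ [a] \<notin> prefixes_lang A" if stuck: "\<nexists>t. avail A (D w) a t"
    proof
      assume "w @ [a] \<in> prefixes_lang A"
      then obtain v c where "reach A (init A, 0) (w @ a # v) c"
        by (auto simp: prefixes_lang_def lang_def)
      then obtain d t where "reach A (init A, 0) w d" "avail A d a t"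
        unfolding reach_append reach_Cons_iff by blast
      then show False using track sim' stuck by blast
    qed
    show "fst (apply_trans (\<sigma> w a) (D w)) \<in> set (final A)"
      if "avail A (D w) a (\<sigma> w a) \<and> w @ [a] \<in> lang A"
    proof -
      from that obtain c where "reach A (init A, 0) (w @ [a]) c" "fst c \<in> set (final A)"
        by (auto simp: lang_def)
      then have "fst (D (w @ [a])) \<in> set (final A)" using track fin by blast
      then show ?thesis by (simp add: D_def \<sigma>_def)
    qed
  qed
  then show ?thesis by (auto simp: history_deterministic_def)
qed

section \<open>Two-counter machines and their automata\<close>

datatype instr = Inc bool nat | Jzd bool nat nat

fun ctr :: "instr \<Rightarrow> bool" where
  "ctr (Inc i l) = i"
| "ctr (Jzd i l l') = i"

text \<open>An increment takes the same branch for both outcomes, so every instruction can be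
  treated as a zero test of its counter.\<close>

fun branch :: "instr \<Rightarrow> bool \<Rightarrow> int \<times> nat" where
  "branch (Inc i l) z = (1, l)"
| "branch (Jzd i l l') z = (if z then (0, l) else (-1, l'))"

type_synonym mconf = "nat \<times> (bool \<Rightarrow> nat)"

text \<open>Label 0 is the halting label, so the instruction at index 0 is never executed.\<close>

fun step :: "instr list \<Rightarrow> mconf \<Rightarrow> mconf" where
  "step P (l, k) = (if l = 0 \<or> length P \<le> l then (l, k) else
     (let i = ctr (P ! l); b = branch (P ! l) (k i = 0)
      in (snd b, k(i := nat (int (k i) + fst b)))))"

definition halts :: "instr list \<Rightarrow> mconf \<Rightarrow> bool" where
  "halts P c \<longleftrightarrow> (\<exists>m. fst ((step P ^^ m) c) = 0)"

text \<open>Component \<open>j\<close> stores counter \<open>j\<close>. A letter is a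
  claim about the counter that the current instruction tests: 0 for zero, 1 for positive.
  A component can check only the claims about its own counter: a false one is a dead end for
  component \<open>False\<close> and leads component \<open>True\<close> to the accepting sink 0, which is also
  the halting state of component \<open>False\<close>.\<close>

definition state :: "bool \<Rightarrow> nat \<Rightarrow> nat" where
  "state j l = 4 * l + (if j then 2 else 0)"

text \<open>A claim about the other component's counter is believed and only selects the next label.
  Claims are checked on the own counter even at increments.\<close>

definition instr_trans :: "bool \<Rightarrow> nat \<Rightarrow> instr \<Rightarrow> trans list" where
  "instr_trans j l x = (let (d, l0) = branch x True; (d', l1) = branch x False in
     if ctr x = j then
       [(state j l, True, 0, d, state j l0), (state j l, False, 1, d', state j l1)] @
       (if j then [(state j l, False, 0, 0, 0), (state j l, True, 1, 0, 0)] else [])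
     else
       [(state j l, True, 0, 0, state j l0), (state j l, False, 0, 0, state j l0),
        (state j l, True, 1, 0, state j l1), (state j l, False, 1, 0, state j l1)])"

text \<open>Both choices read the same letter, so the letter does not guide Eve. They require a
  positive counter, which is why the loaded number is assumed positive below.\<close>

definition core :: "instr list \<Rightarrow> trans list" where
  "core P = [(0, True, 0, 0, 0), (0, False, 0, 0, 0), (0, True, 1, 0, 0), (0, False, 1, 0, 0),
      (1, False, 0, 0, state False 1), (1, False, 0, 0, state True 1)] @
     concat (map (\<lambda>l. instr_trans False l (P ! l) @ instr_trans True l (P ! l)) [1..<length P])"

text \<open>The loading states are odd and count down to the choice state 1, so that \<open>core P\<close> does not
  depend on the number loaded.\<close>

primrec chain :: "trans list \<Rightarrow> nat \<Rightarrow> trans list" where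
  "chain T 0 = T"
| "chain T (Suc n) = (2 * n + 3, True, 0, 1, 2 * n + 1) # (2 * n + 3, False, 0, 1, 2 * n + 1) # chain T n"

text \<open>The number of states depends on \<open>n\<close> alone. For
  \<open>n = 2 ^ core_code P\<close> it also covers the states of \<open>core P\<close>, see
  \<open>machine_oca_wf\<close>.\<close>

definition machine_oca :: "instr list \<Rightarrow> nat \<Rightarrow> oca" where
  "machine_oca P n = \<lparr>nstates = 2 * n + 2, nletters = 2, delta = chain (core P) n,
     init = 2 * n + 1, final = [0]\<rparr>"

lemma set_chain: "set (chain T n) = (\<Union>j<n. \<Union>z. {(2 * j + 3, z, 0, 1, 2 * j + 1)}) \<union> set T"
  by (induction n) (auto simp: lessThan_Suc UNIV_bool)

lemma branch_cases: "fst (branch x True) \<in> {0, 1}" "fst (branch x False) \<in> {-1, 1}"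
  by (cases x; simp)+

section \<open>Available transitions\<close>

lemma avail_iff:
  "avail (machine_oca P n) (q, m) a t \<longleftrightarrow>
    (\<exists>d q'. t = (q, m = 0, a, d, q') \<and> (m = 0 \<longrightarrow> d \<in> {0, 1}) \<and>
      t \<in> (\<Union>j<n. \<Union>z. {(2 * j + 3, z, 0, 1, 2 * j + 1)}) \<union> set (core P))"
  by (cases t) (auto simp: avail_def machine_oca_def set_chain)

lemma instr_trans_source: "(q, r) \<in> set (instr_trans j l x) \<Longrightarrow> q = state j l"
  by (auto simp: instr_trans_def split: prod.splits if_splits)

lemma core_iff:
  "(q, r) \<in> set (core P) \<longleftrightarrow> (q, r) \<in> (\<Union>z. \<Union>a\<in>{0, 1}. {(0, z, a, 0, 0)}) \<or>
    (\<exists>j. (q, r) = (1, False, 0, 0, state j 1)) \<or>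
    (\<exists>j l. 1 \<le> l \<and> l < length P \<and> q = state j l \<and> (q, r) \<in> set (instr_trans j l (P ! l)))"
  unfolding core_def by (auto simp: UNIV_bool ex_bool_eq dest: instr_trans_source)

lemma state_eq_iff: "state j l = state j' l' \<longleftrightarrow> j = j' \<and> l = l'"
  unfolding state_def by (auto split: if_splits) presburger+

lemma even_state [simp]: "even (state j l)"
  by (simp add: state_def)

lemma state_neq [simp]:
  "state j l \<noteq> Suc (2 * i)" "Suc (2 * i) \<noteq> state j l" "state j l \<noteq> Suc 0" "Suc 0 \<noteq> state j l"
  "state j l \<noteq> 2 * i + 3" "2 * i + 3 \<noteq> state j l"
  unfolding state_def by (cases j; presburger)+

lemma state_eq_0 [simp]: "state j l = 0 \<longleftrightarrow> \<not> j \<and> l = 0" "0 = state j l \<longleftrightarrow> \<not> j \<and> l = 0"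
  by (auto simp: state_def)

lemma avail_chain:
  "avail (machine_oca P n) (2 * j + 3, m) a t \<longleftrightarrow>
    j < n \<and> a = 0 \<and> t = (2 * j + 3, m = 0, 0, 1, 2 * j + 1)"
  unfolding avail_iff by (auto simp: core_iff)

lemma avail_choice:
  "avail (machine_oca P n) (1, m) a t \<longleftrightarrow>
    m > 0 \<and> a = 0 \<and> (\<exists>j. t = (1, False, 0, 0, state j 1))"
  unfolding avail_iff by (auto simp: core_iff)

lemma avail_sink:
  "avail (machine_oca P n) (0, m) a t \<longleftrightarrow> a \<in> {0, 1} \<and> t = (0, m = 0, a, 0, 0)"
  unfolding avail_iff by (auto simp: core_iff)

lemma avail_state:
  assumes "j \<or> l \<noteq> 0"
  shows "avail (machine_oca P n) (state j l, m) a t \<longleftrightarrow>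
    1 \<le> l \<and> l < length P \<and> a \<in> {0, 1} \<and>
    (if ctr (P ! l) \<noteq> j then t = (state j l, m = 0, a, 0, state j (snd (branch (P ! l) (a = 0))))
     else if m = 0 \<longleftrightarrow> a = 0
     then t = (state j l, m = 0, a, fst (branch (P ! l) (m = 0)), state j (snd (branch (P ! l) (m = 0))))
     else j \<and> t = (state j l, m = 0, a, 0, 0))"
proof -
  have "avail (machine_oca P n) (state j l, m) a t \<longleftrightarrow>
    1 \<le> l \<and> l < length P \<and> (\<exists>d q'. t = (state j l, m = 0, a, d, q') \<and> (m = 0 \<longrightarrow> d \<in> {0, 1}) \<and>
      t \<in> set (instr_trans j l (P ! l)))"
    unfolding avail_iff using assms by (auto simp: core_iff state_eq_iff)
  also have "\<dots> \<longleftrightarrow> 1 \<le> l \<and> l < length P \<and> a \<in> {0, 1} \<and>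
    (if ctr (P ! l) \<noteq> j then t = (state j l, m = 0, a, 0, state j (snd (branch (P ! l) (a = 0))))
     else if m = 0 \<longleftrightarrow> a = 0
     then t = (state j l, m = 0, a, fst (branch (P ! l) (m = 0)), state j (snd (branch (P ! l) (m = 0))))
     else j \<and> t = (state j l, m = 0, a, 0, 0))"
    using branch_cases[of "P ! l"]
    by (cases "ctr (P ! l) = j"; cases "m = 0"; cases j)
      (auto simp: instr_trans_def case_prod_beta)
  finally show ?thesis .
qed

lemma state_cases:
  obtains (chain) j where "q = 2 * j + 3" | (choice) "q = 1" | (sink) "q = 0"
  | (state) j l where "q = state j l" "j \<or> l \<noteq> 0"
proof (cases "even q")
  case True
  then have "q = state False (q div 4) \<or> q = state True (q div 4)"
    unfolding state_def by presburger
  then show ?thesis using sink state by (metis state_eq_0(1))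
next
  case False
  then have "q = 1 \<or> q = 2 * ((q - 3) div 2) + 3" by presburger
  then show ?thesis using chain choice by blast
qed

text \<open>State 1 is the only place where Eve has a real choice, so elsewhere her move can be
  given by \<open>SOME\<close>.\<close>

lemma avail_unique:
  assumes "avail (machine_oca P n) (q, m) a t" "avail (machine_oca P n) (q, m) a t'" "q \<noteq> 1"
  shows "t = t'"
  using assms
  by (cases q rule: state_cases) (auto simp: avail_chain avail_sink avail_state split: if_splits)

lemma avail_letter: "avail (machine_oca P n) (q, m) a t \<Longrightarrow> a \<in> {0, 1}"
  by (cases q rule: state_cases) (auto simp: avail_chain avail_choice[simplified] avail_sink avail_state)

lemma avail_even: "avail (machine_oca P n) (q, m) a t \<Longrightarrow> even q \<Longrightarrow> even (fst (apply_trans t (q, m)))"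
  by (cases q rule: state_cases)
    (auto simp: avail_sink avail_state apply_trans_def split: if_splits)

lemma machine_oca_simps [simp]:
  "init (machine_oca P n) = 2 * n + 1" "final (machine_oca P n) = [0]" "nletters (machine_oca P n) = 2"
  by (simp_all add: machine_oca_def)

section \<open>Correctness of the reduction\<close>

theorem history_deterministic_if_not_halts:
  assumes n: "n > 0" and nh: "\<not> halts P (1, \<lambda>_. n)"
  shows "history_deterministic (machine_oca P n)"
proof -
  let ?A = "machine_oca P n"
  \<comment> \<open>Three situations are related: equal configurations, during the loading or past
    the choice; Eve in the accepting sink, which simulates everything; and both components in step
    with the same run of \<open>P\<close>, each holding its own counter.\<close>
  define R where "R c e \<longleftrightarrow> (c = e \<and> (even (fst c) \<or> (\<exists>j\<le>n. c = (2 * j + 1, n - j)))) \<or> fst e = 0 \<or>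
    (\<exists>m l k. (step P ^^ m) (1, \<lambda>_. n) = (l, k) \<and> c = (state False l, k False) \<and> e = (state True l, k True))"
    for c e :: config
  define pick where "pick e a = (if fst e = 1 then (1, False, 0, 0, state True 1)
    else SOME t. avail ?A e a t)" for e a
  have R_sim: "R (state False l, k False) (state True l, k True)"
    if "(step P ^^ m) (1, \<lambda>_. n) = (l, k)" for m l k
    unfolding R_def using that by (intro disjI2 exI[of _ m] exI[of _ l] exI[of _ k]) simp
  have pick: "pick e a = t" if "avail ?A e a t" "fst e \<noteq> 1" for e a t
  proof -
    have "avail ?A e a (SOME t. avail ?A e a t)" using that(1) by (rule someI)
    then show ?thesis using that avail_unique[of P n "fst e" "snd e"] by (simp add: pick_def)
  qed
  have sim: "avail ?A e a (pick e a) \<and> R (apply_trans t c) (apply_trans (pick e a) e)"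
    if R: "R c e" and t: "avail ?A c a t" for c e a t
  proof -
    consider (same) "c = e" "even (fst c)" | (chain) j where "j \<le> n" "c = (2 * j + 1, n - j)" "e = c"
      | (sink) "fst e = 0"
      | (sim) m l k where "(step P ^^ m) (1, \<lambda>_. n) = (l, k)" "c = (state False l, k False)"
        "e = (state True l, k True)"
      using R unfolding R_def by (elim disjE conjE exE) metis+
    then show ?thesis
    proof cases
      case same
      then have "fst e \<noteq> 1" by auto
      then have "pick e a = t" using pick t same by blast
      then show ?thesis using t same avail_even[of P n "fst c" "snd c"] by (simp add: R_def)
    next
      case chain
      show ?thesis
      proof (cases j)
        case 0
        then have c: "c = (1, n)" using chain by simp
        from t obtain i where a: "a = 0" and i: "t = (1, False, 0, 0, state i 1)"
          unfolding c avail_choice by blast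
        have p: "pick e a = (1, False, 0, 0, state True 1)"
          using chain c by (simp add: pick_def)
        have "avail ?A (1, n) 0 (1, False, 0, 0, state True 1)"
          unfolding avail_choice using n by blast
        then have "avail ?A e a (pick e a)" using a c chain(3) p by simp
        moreover have "R (state i 1, n) (state True 1, n)"
        proof (cases i)
          case False
          then show ?thesis using R_sim[of 0 1 "\<lambda>_. n"] by simp
        qed (simp add: R_def)
        ultimately show ?thesis unfolding p unfolding chain(3) i c by (simp add: apply_trans_def)
      next
        case (Suc j')
        then have c: "c = (2 * j' + 3, n - Suc j')" using chain by simp
        then have p: "pick e a = t" using chain t by (intro pick) auto
        from t have "t = (2 * j' + 3, n - Suc j' = 0, 0, 1, 2 * j' + 1)"
          unfolding c avail_chain by simp
        then have "apply_trans t c = (2 * j' + 1, n - j')"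
          using chain(1) Suc by (auto simp: c apply_trans_def)
        moreover have "j' \<le> n" using chain(1) Suc by simp
        ultimately show ?thesis using p t chain(3) by (auto simp: R_def)
      qed
    next
      case sink
      then obtain m where e: "e = (0, m)" by (cases e) auto
      have "a \<in> {0, 1}" using t avail_letter[of P n "fst c" "snd c"] by simp
      then have av: "avail ?A e a (0, m = 0, a, 0, 0)" unfolding e avail_sink by simp
      then have "pick e a = (0, m = 0, a, 0, 0)" using pick sink by simp
      then show ?thesis using av by (simp add: R_def apply_trans_def)
    next
      case sim
      \<comment> \<open>At label 0 component \<open>False\<close> would be in the accepting sink;
        non-termination of \<open>P\<close> excludes this.\<close>
      have "l \<noteq> 0" using nh sim(1) by (auto simp: halts_def dest: spec[of _ m])
      then have l: "True \<or> l \<noteq> 0" "False \<or> l \<noteq> 0" by simp_all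
      note av = t[unfolded sim(2) avail_state[OF l(2)]]
      let ?b = "branch (P ! l)"
      have step: "(step P ^^ Suc m) (1, \<lambda>_. n) = step P (l, k)" using sim(1) by simp
      have ne: "fst e \<noteq> 1" using sim(3) by simp
      show ?thesis
      proof (cases "ctr (P ! l)")
        case False
        \<comment> \<open>Component \<open>False\<close> can move only if the claim about its
          counter is true; component \<open>True\<close> believes the claim, so both follow the
          machine.\<close>
        from av False have a: "k False = 0 \<longleftrightarrow> a = 0" and
          t': "t = (state False l, k False = 0, a, fst (?b (k False = 0)), state False (snd (?b (k False = 0))))"
          by (auto split: if_splits)
        have av': "avail ?A e a (state True l, k True = 0, a, 0, state True (snd (?b (a = 0))))"
          unfolding sim(3) avail_state[OF l(1)] using av False by simp
        have "step P (l, k) = (snd (?b (a = 0)), k(False := nat (int (k False) + fst (?b (a = 0)))))"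
          using av a False by (simp add: Let_def)
        from R_sim[OF step[unfolded this]] show ?thesis unfolding pick[OF av' ne]
          using av' by (simp add: sim t' a apply_trans_def)
      next
        case True
        from av True have t': "t = (state False l, k False = 0, a, 0, state False (snd (?b (a = 0))))"
          by (auto split: if_splits)
        show ?thesis
        proof (cases "k True = 0 \<longleftrightarrow> a = 0")
          case a: True
          have av': "avail ?A e a (state True l, k True = 0, a, fst (?b (a = 0)), state True (snd (?b (a = 0))))"
            unfolding sim(3) avail_state[OF l(1)] using av True a by simp
          have "step P (l, k) = (snd (?b (a = 0)), k(True := nat (int (k True) + fst (?b (a = 0)))))"
            using av a True by (simp add: Let_def)
          from R_sim[OF step[unfolded this]] show ?thesis unfolding pick[OF av' ne]
            using av' by (simp add: sim t' a apply_trans_def)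
        next
          case a: False
          \<comment> \<open>The claim about the second counter is false, so Eve enters the accepting
            sink.\<close>
          have av': "avail ?A e a (state True l, k True = 0, a, 0, 0)"
            unfolding sim(3) avail_state[OF l(1)] using av True a by simp
          then show ?thesis unfolding pick[OF av' ne] R_def by (simp add: apply_trans_def)
        qed
      qed
    qed
  qed
  show ?thesis
  proof (rule history_deterministic_by_simulation[of R, OF _ sim])
    show "R (init ?A, 0) (init ?A, 0)" by (auto simp: R_def)
    show "fst e \<in> set (final ?A)" if "R c e" "fst c \<in> set (final ?A)" for c e
    proof -
      have "False" if "(step P ^^ m) (1, \<lambda>_. n) = (0, k)" for m k
        using nh that unfolding halts_def by (metis fst_conv)
      then show ?thesis using that by (auto simp: R_def)
    qed
  qed
qed

lemma eve_winning_move: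
  assumes "eve_winning A \<sigma>" "reached A \<sigma> w" "a < nletters A" "avail A (conf A \<sigma> w) a t"
  shows "avail A (conf A \<sigma> w) a (\<sigma> w a)" "reached A \<sigma> (w @ [a])"
    "w @ [a] \<in> lang A \<Longrightarrow> fst (conf A \<sigma> (w @ [a])) \<in> set (final A)"
  using assms unfolding eve_winning_def conf_snoc by (blast intro: reached_snoc)+

text \<open>The condition on \<open>P ! 1\<close> puts a test of the second counter right after the
  choice. That counter is still \<open>n > 0\<close>, so letter 0 is a false claim with which Adam
  can punish the choice of component \<open>False\<close>.\<close>

theorem not_history_deterministic_if_halts:
  assumes n: "n > 0" and P: "length P > 1" "P ! 1 = Jzd True 2 1" and h: "halts P (1, \<lambda>_. n)"
  shows "\<not> history_deterministic (machine_oca P n)"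
proof
  let ?A = "machine_oca P n"
  assume "history_deterministic ?A"
  then obtain \<sigma> where win: "eve_winning ?A \<sigma>" by (auto simp: history_deterministic_def)
  note move = eve_winning_move[OF win, unfolded machine_oca_simps]
  let ?c = "conf ?A \<sigma>" and ?r = "reached ?A \<sigma>" and ?R = "reach ?A (2 * n + 1, 0)"
  \<comment> \<open>Eve's play and a run are recorded side by side, because after the choice the run
    may continue in the other component.\<close>
  have chain: "i \<le> n \<Longrightarrow> ?r (replicate i 0) \<and> ?c (replicate i 0) = (2 * (n - i) + 1, i) \<and>
    ?R (replicate i 0) (2 * (n - i) + 1, i)" for i
  proof (induction i)
    case 0
    then show ?case by (simp add: conf_Nil reached_nil reach_nil)
  next
    case (Suc i)
    let ?w = "replicate i 0" and ?j = "n - Suc i"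
    have "2 * (n - i) + 1 = 2 * ?j + 3" using Suc.prems by simp
    then have w: "?r ?w" "?c ?w = (2 * ?j + 3, i)" "?R ?w (2 * ?j + 3, i)"
      using Suc.IH Suc.prems by (metis Suc_leD)+
    have av: "avail ?A (?c ?w) 0 t \<longleftrightarrow> t = (2 * ?j + 3, i = 0, 0, 1, 2 * ?j + 1)" for t
      unfolding w(2) avail_chain using Suc.prems by auto
    from move(1,2)[OF w(1) _ av[THEN iffD2, OF refl]]
    have m: "avail ?A (?c ?w) 0 (\<sigma> ?w 0)" "?r (?w @ [0])" by simp_all
    have "?c (?w @ [0]) = (2 * ?j + 1, Suc i)"
      using m(1) unfolding av conf_snoc by (simp add: w(2) apply_trans_def)
    moreover have "?R (?w @ [0]) (2 * ?j + 1, Suc i)"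
      using reach_snoc[OF w(3), of 0 "\<sigma> ?w 0"] m(1) unfolding av
      using av[of "\<sigma> ?w 0"] nat_int[of "Suc i"] by (simp add: w(2) apply_trans_def add.commute)
    ultimately show ?case using m(2) by (simp add: replicate_append_same)
  qed
  let ?w = "replicate n 0"
  have w: "?r ?w" "?c ?w = (1, n)" "?R ?w (1, n)" using chain[of n] by simp_all
  have av: "avail ?A (1, n) 0 (1, False, 0, 0, state j 1)" for j
    unfolding avail_choice using n by blast
  have m: "avail ?A (1, n) 0 (\<sigma> ?w 0)" "?r (?w @ [0])"
    using move(1,2)[OF w(1), of 0, unfolded w(2), OF _ av] by simp_all
  then obtain j where j: "\<sigma> ?w 0 = (1, False, 0, 0, state j 1)" unfolding avail_choice by blast
  have cj: "?c (?w @ [0]) = (state j 1, n)" by (simp add: conf_snoc w(2) j apply_trans_def)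
  have Rj: "?R (?w @ [0]) (state i 1, n)" for i
    using reach_snoc[OF w(3) av[of i]] by (simp add: apply_trans_def)
  show False
  proof (cases j)
    case False
    have "avail ?A (state True 1, n) 0 (state True 1, False, 0, 0, 0)"
      using P n by (subst avail_state) auto
    from reach_snoc[OF Rj this] have "(?w @ [0]) @ [0] \<in> lang ?A"
      by (auto simp: lang_def apply_trans_def simp del: append_assoc)
    moreover have av': "avail ?A (?c (?w @ [0])) 0 t \<longleftrightarrow> t = (state False 1, False, 0, 0, state False 2)" for t
      unfolding cj using False P n by (subst avail_state) auto
    ultimately have "fst (?c ((?w @ [0]) @ [0])) = 0"
      using move(3)[OF m(2), of 0] by simp
    moreover have "\<sigma> (?w @ [0]) 0 = (state False 1, False, 0, 0, state False 2)"
      using move(1)[OF m(2), of 0] av' by simp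
    ultimately show False unfolding conf_snoc by (simp add: apply_trans_def)
  next
    case True
    \<comment> \<open>Adam wins in the round of the last letter, so the word is kept in the form
      \<open>u @ [a]\<close> together with the premises of \<open>move(3)\<close> for that round.
      For \<open>m = 0\<close> this is the round of the choice.\<close>
    have run: "\<exists>u a. ?r (u @ [a]) \<and> a < 2 \<and> (\<exists>t. avail ?A (?c u) a t) \<and> ?r u \<and>
      (case (step P ^^ m) (1, \<lambda>_. n) of (l, k) \<Rightarrow>
        ?c (u @ [a]) = (state True l, k True) \<and> ?R (u @ [a]) (state False l, k False))" for m
    proof (induction m)
      case 0
      then show ?case using w m cj Rj[of False] True av
        by (intro exI[of _ ?w] exI[of _ 0] conjI exI[of _ "\<sigma> ?w 0"]) simp_all
    next
      case (Suc m)
      obtain l k where lk: "(step P ^^ m) (1, \<lambda>_. n) = (l, k)" by fastforce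
      from Suc obtain u0 a0 where IH: "?r (u0 @ [a0])" "a0 < 2" "\<exists>t. avail ?A (?c u0) a0 t" "?r u0"
        "?c (u0 @ [a0]) = (state True l, k True)" "?R (u0 @ [a0]) (state False l, k False)"
        unfolding lk prod.case by blast
      show ?case
      proof (cases "l = 0 \<or> length P \<le> l")
        case True
        \<comment> \<open>A stopped machine is at a fixed point of \<open>step\<close>, so the same
          word serves again.\<close>
        then show ?thesis using IH lk by (intro exI[of _ u0] exI[of _ a0]) simp
      next
        case False
        then have l: "True \<or> l \<noteq> 0" "False \<or> l \<noteq> 0" by simp_all
        let ?u = "u0 @ [a0]" and ?b = "branch (P ! l)"
        \<comment> \<open>Adam announces the true outcome of the test, which both components accept
          as correct.\<close>
        define z where "z \<longleftrightarrow> k (ctr (P ! l)) = 0"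
        define a :: nat where "a = (if z then 0 else 1)"
        have az: "a = 0 \<longleftrightarrow> z" by (simp add: a_def)
        define t where "t i = (state i l, k i = 0, a, if ctr (P ! l) = i then fst (?b z) else 0,
          state i (snd (?b z)))" for i
        have avt: "avail ?A (state i l, k i) a s \<longleftrightarrow> s = t i" for i s
          using False by (subst avail_state) (auto simp: t_def a_def z_def)
        have st: "step P (l, k) = (snd (?b z), k(ctr (P ! l) := nat (int (k (ctr (P ! l))) + fst (?b z))))"
          using False by (simp add: Let_def z_def)
        have ap: "apply_trans (t i) (state i l, k i) = (state i (fst (step P (l, k))), snd (step P (l, k)) i)" for i
          unfolding st by (simp add: t_def apply_trans_def)
        have a2: "a < 2" by (simp add: a_def)
        have av: "avail ?A (?c ?u) a (t True)" unfolding IH(5) avt ..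
        have mv: "avail ?A (?c ?u) a (\<sigma> ?u a)" "?r (?u @ [a])" using move(1,2)[OF IH(1) a2 av] .
        have \<sigma>t: "\<sigma> ?u a = t True" using mv(1) unfolding IH(5) avt .
        have "?c (?u @ [a]) = (state True (fst (step P (l, k))), snd (step P (l, k)) True)"
          unfolding conf_snoc[of _ _ ?u] IH(5) \<sigma>t ap ..
        moreover have "?R (?u @ [a]) (state False (fst (step P (l, k))), snd (step P (l, k)) False)"
          using reach_snoc[OF IH(6) avt[THEN iffD2, OF refl]] unfolding ap .
        ultimately show ?thesis using mv(2) a2 av IH(1) lk
          by (intro exI[of _ ?u] exI[of _ a] conjI exI[of _ "t True"])
            (simp_all add: case_prod_beta del: step.simps)
      qed
    qed
    from h obtain m where "fst ((step P ^^ m) (1, \<lambda>_. n)) = 0" by (auto simp: halts_def)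
    then obtain k where "(step P ^^ m) (1, \<lambda>_. n) = (0, k)" by (metis prod.collapse)
    with run[of m] obtain u a t where u: "?r u" "a < 2" "avail ?A (?c u) a t"
      "?c (u @ [a]) = (state True 0, k True)" "?R (u @ [a]) (state False 0, k False)" by auto
    \<comment> \<open>\<open>state False 0\<close> is the final state 0, whereas Eve is in
      \<open>state True 0\<close>, which is 2 and not final.\<close>
    have "u @ [a] \<in> lang ?A" using u(5) by (auto simp: lang_def state_def)
    with move(3)[OF u(1-3)] u(4) show False by simp
  qed
qed

section \<open>Two-counter machines for loop programs\<close>

definition run :: "instr list \<Rightarrow> mconf \<Rightarrow> mconf \<Rightarrow> bool" where
  "run P c d \<longleftrightarrow> (\<exists>m. (step P ^^ m) c = d)"

lemma run_refl: "run P c c"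
  unfolding run_def by (auto intro: exI[of _ 0])

lemma run_trans:
  assumes "run P c d" "run P d e"
  shows "run P c e"
proof -
  obtain i j where "(step P ^^ i) c = d" "(step P ^^ j) d = e" using assms by (auto simp: run_def)
  then have "(step P ^^ (j + i)) c = e" by (simp add: funpow_add)
  then show ?thesis unfolding run_def ..
qed

lemma run_step: "step P c = d \<Longrightarrow> run P d e \<Longrightarrow> run P c e"
  by (rule run_trans[of _ _ d]) (auto simp: run_def intro: exI[of _ 1])

text \<open>\<open>k \<noteq> 0\<close> keeps blocks off the halting label, where
  \<open>step\<close> executes nothing.\<close>

definition code_at :: "instr list \<Rightarrow> nat \<Rightarrow> instr list \<Rightarrow> bool" where
  "code_at P k xs \<longleftrightarrow> k \<noteq> 0 \<and> (\<forall>i<length xs. k + i < length P \<and> P ! (k + i) = xs ! i)"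

lemma code_at_append:
  "code_at P k (xs @ ys) \<longleftrightarrow> code_at P k xs \<and> code_at P (k + length xs) ys"
proof
  assume a: "code_at P k (xs @ ys)"
  have "k + i < length P \<and> P ! (k + i) = (xs @ ys) ! i" if "i < length xs + length ys" for i
    using a that by (simp add: code_at_def)
  from this[of "length xs + _"] this show "code_at P k xs \<and> code_at P (k + length xs) ys"
    using a by (fastforce simp: code_at_def nth_append add.assoc)
next
  assume a: "code_at P k xs \<and> code_at P (k + length xs) ys"
  have "k + i < length P \<and> P ! (k + i) = (xs @ ys) ! i" if "i < length xs + length ys" for i
  proof (cases "i < length xs")
    case False
    then have "k + length xs + (i - length xs) = k + i" "i - length xs < length ys" using that by auto
    moreover have "\<forall>i<length ys. k + length xs + i < length P \<and> P ! (k + length xs + i) = ys ! i"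
      using a by (simp add: code_at_def)
    ultimately show ?thesis using False by (metis nth_append)
  qed (use a in \<open>simp add: code_at_def nth_append\<close>)
  then show "code_at P k (xs @ ys)" using a by (simp add: code_at_def)
qed

lemma code_at_Cons: "code_at (x # xs) 1 xs"
  by (simp add: code_at_def)

lemma step_Inc:
  "code_at P k xs \<Longrightarrow> i < length xs \<Longrightarrow> xs ! i = Inc j l \<Longrightarrow>
    step P (k + i, c) = (l, c(j := Suc (c j)))"
  by (auto simp: code_at_def Let_def nat_add_distrib)

lemma step_Jzd:
  "code_at P k xs \<Longrightarrow> i < length xs \<Longrightarrow> xs ! i = Jzd j l l' \<Longrightarrow>
    step P (k + i, c) = (if c j = 0 then (l, c) else (l', c(j := c j - 1)))"
  by (auto simp: code_at_def Let_def nat_diff_distrib)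

text \<open>Entering the block at \<open>k + i\<close> instead of \<open>k\<close> first adds \<open>i\<close> to the target counter; this is how
  a remainder is restored after a failed division.\<close>

definition transfer :: "nat \<Rightarrow> bool \<Rightarrow> nat \<Rightarrow> nat \<Rightarrow> instr list" where
  "transfer p j k e = Jzd j e (k + p) # map (\<lambda>i. Inc (\<not> j) (k + i)) [0..<p]"

lemma length_transfer [simp]: "length (transfer p j k e) = Suc p"
  by (simp add: transfer_def)

lemma run_transfer_entry:
  assumes "code_at P k (transfer p j k e)" "i \<le> p"
  shows "run P (k + i, c) (k, c((\<not> j) := c (\<not> j) + i))"
  using assms(2)
proof (induction i arbitrary: c)
  case 0
  then show ?case by (simp add: run_refl)
next
  case (Suc i)
  have "step P (k + Suc i, c) = (k + i, c((\<not> j) := Suc (c (\<not> j))))"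
    using Suc.prems by (intro step_Inc[OF assms(1)]) (auto simp: transfer_def)
  moreover have "run P (k + i, c((\<not> j) := Suc (c (\<not> j)))) (k, c((\<not> j) := c (\<not> j) + Suc i))"
    using Suc.IH[of "c((\<not> j) := Suc (c (\<not> j)))"] Suc.prems
    by (simp only: fun_upd_same fun_upd_upd add_Suc add_Suc_right Suc_leD)
  ultimately show ?case by (rule run_step)
qed

text \<open>Each decrement of counter \<open>j\<close> jumps to \<open>k + p\<close>, from where all
  \<open>p\<close> increments of the other counter are passed on the way back to
  \<open>k\<close>.\<close>

lemma run_transfer:
  assumes "code_at P k (transfer p j k e)"
  shows "run P (k, c) (e, c(j := 0, (\<not> j) := c (\<not> j) + p * c j))"
proof (induction "c j" arbitrary: c)
  case 0
  have "step P (k + 0, c) = (e, c)"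
    using 0 by (subst step_Jzd[OF assms]) (auto simp: transfer_def)
  moreover have "c(j := 0, (\<not> j) := c (\<not> j) + p * c j) = c"
    using 0 by auto
  ultimately show ?case by (metis add_0_right run_step run_refl)
next
  case (Suc m)
  let ?d = "c(j := m, (\<not> j) := c (\<not> j) + p)"
  have "step P (k + 0, c) = (k + p, c(j := m))"
    using Suc(2)[symmetric] by (subst step_Jzd[OF assms]) (auto simp: transfer_def)
  moreover have "run P (k + p, c(j := m)) (k, ?d)"
    using run_transfer_entry[OF assms order_refl, of "c(j := m)"] by simp
  moreover have "run P (k, ?d) (e, ?d(j := 0, (\<not> j) := ?d (\<not> j) + p * ?d j))"
    using Suc(1)[of ?d] by simp
  moreover have "?d(j := 0, (\<not> j) := ?d (\<not> j) + p * ?d j) = c(j := 0, (\<not> j) := c (\<not> j) + p * c j)"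
    using Suc(2)[symmetric] by (auto simp: fun_eq_iff)
  ultimately show ?case by (metis add_0_right run_step run_trans)
qed

definition two :: "nat \<Rightarrow> nat \<Rightarrow> bool \<Rightarrow> nat" where
  "two a b i = (if i then b else a)"

lemma two_simps [simp]:
  "two a b False = a" "two a b True = b" "(two a b)(False := x) = two x b" "(two a b)(True := x) = two a x"
  by (auto simp: two_def fun_eq_iff)

text \<open>Counter \<open>False\<close> is moved into the other counter with factor
  \<open>p\<close> and then moved back with factor 1.\<close>

definition mul_code :: "nat \<Rightarrow> nat \<Rightarrow> instr list" where
  "mul_code p k = transfer p False k (k + p + 1) @ transfer 1 True (k + p + 1) (k + p + 3)"

lemma length_mul_code [simp]: "length (mul_code p k) = p + 3"
  by (simp add: mul_code_def)

lemma run_mul_code: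
  assumes "code_at P k (mul_code p k)"
  shows "run P (k, two n 0) (k + p + 3, two (n * p) 0)"
proof -
  have c: "code_at P k (transfer p False k (k + p + 1))"
    "code_at P (k + p + 1) (transfer 1 True (k + p + 1) (k + p + 3))"
    using assms by (simp_all add: mul_code_def code_at_append)
  show ?thesis
    using run_trans[OF run_transfer[OF c(1), of "two n 0"] run_transfer[OF c(2)]]
    by (simp add: mult.commute)
qed

text \<open>The first block subtracts \<open>p\<close> repeatedly and counts the rounds in counter
  \<open>True\<close>. Running empty at offset \<open>i\<close> shows that the remainder is
  \<open>i\<close>. For \<open>i = 0\<close> the quotient is moved back; otherwise the last block is
  entered at offset \<open>i\<close>, which restores first the remainder and then \<open>p\<close>
  times the quotient.\<close>

definition div_code :: "nat \<Rightarrow> nat \<Rightarrow> nat \<Rightarrow> nat \<Rightarrow> instr list" where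
  "div_code p k y e =
     (map (\<lambda>i. Jzd False (if i = 0 then k + p + 1 else k + p + 3 + i) (k + Suc i)) [0..<p] @ [Inc True k]) @
     transfer 1 True (k + p + 1) y @ transfer p True (k + p + 3) e"

lemma length_div_code [simp]: "length (div_code p k y e) = 2 * p + 4"
  by (simp add: div_code_def)

text \<open>Strong induction on \<open>n\<close>, since a full round removes \<open>p\<close>. The
  exit labels are abstracted to \<open>f\<close>, as the loop itself only determines the
  remainder.\<close>

lemma run_div_code_loop:
  assumes c: "code_at P k (map (\<lambda>i. Jzd False (f i) (k + Suc i)) [0..<p] @ [Inc True k])"
    (is "code_at P k ?xs") and p: "p > 0"
  shows "run P (k, two n b) (f (n mod p), two 0 (b + n div p))"
proof (induction n arbitrary: b rule: less_induct)
  case (less n)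
  have dec: "run P (k, two (i + a) b) (k + i, two a b)" if "i \<le> p" for i a
    using that
  proof (induction i arbitrary: a)
    case 0
    then show ?case by (simp add: run_refl)
  next
    case (Suc i)
    have "step P (k + i, two (Suc a) b) = (k + Suc i, two a b)"
      using Suc.prems by (subst step_Jzd[OF c]) (auto simp: nth_append)
    then have "run P (k + i, two (Suc a) b) (k + Suc i, two a b)"
      by (rule run_step) (rule run_refl)
    moreover have "run P (k, two (i + Suc a) b) (k + i, two (Suc a) b)"
      using Suc.IH[of "Suc a"] Suc.prems by simp
    ultimately show ?case using run_trans[of P "(k, two (Suc (i + a)) b)"] by simp
  qed
  show ?case
  proof (cases "n < p")
    case True
    have "step P (k + n, two 0 b) = (f n, two 0 b)"
      using True by (subst step_Jzd[OF c]) (auto simp: nth_append)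
    then have "run P (k + n, two 0 b) (f n, two 0 b)" by (rule run_step) (rule run_refl)
    from run_trans[OF dec[of n 0, simplified] this] show ?thesis using True by simp
  next
    case False
    have "step P (k + p, two (n - p) b) = (k, two (n - p) (Suc b))"
      by (subst step_Inc[OF c]) (auto simp: nth_append)
    moreover have "run P (k, two (n - p) (Suc b)) (f ((n - p) mod p), two 0 (Suc b + (n - p) div p))"
      using False p by (intro less) auto
    moreover have "(n - p) mod p = n mod p" "Suc b + (n - p) div p = b + n div p"
      using False p by (simp_all add: le_mod_geq le_div_geq)
    ultimately have "run P (k + p, two (n - p) b) (f (n mod p), two 0 (b + n div p))"
      by (metis run_step)
    moreover have "run P (k, two n b) (k + p, two (n - p) b)" using dec[of p "n - p"] False by simp
    ultimately show ?thesis by (blast intro: run_trans)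
  qed
qed

lemma run_div_code:
  assumes "code_at P k (div_code p k y e)" and p: "p > 0"
  shows "run P (k, two n 0) (if p dvd n then (y, two (n div p) 0) else (e, two n 0))"
proof -
  let ?f = "\<lambda>i. if i = 0 then k + p + 1 else k + p + 3 + i"
  have c: "code_at P k (map (\<lambda>i. Jzd False (?f i) (k + Suc i)) [0..<p] @ [Inc True k])"
    "code_at P (k + p + 1) (transfer 1 True (k + p + 1) y)"
    "code_at P (k + p + 3) (transfer p True (k + p + 3) e)"
    using assms(1) unfolding div_code_def code_at_append[of _ _ "_ @ [_]"] code_at_append[of _ _ "transfer _ _ _ _"]
    by (simp_all add: algebra_simps eval_nat_numeral)
  have 1: "run P (k, two n 0) (?f (n mod p), two 0 (n div p))"
    using run_div_code_loop[OF c(1) p, of n 0] by simp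
  show ?thesis
  proof (cases "p dvd n")
    case True
    then have "?f (n mod p) = k + p + 1" by auto
    then show ?thesis using run_trans[OF 1, of "(y, two (n div p) 0)"] run_transfer[OF c(2), of "two 0 (n div p)"] True
      by simp
  next
    case False
    then have "?f (n mod p) = k + p + 3 + n mod p" by (auto simp: dvd_eq_mod_eq_0)
    moreover have "run P (k + p + 3 + n mod p, two 0 (n div p)) (k + p + 3, two (n mod p) (n div p))"
      using run_transfer_entry[OF c(3), of "n mod p" "two 0 (n div p)"] p by simp
    moreover have "run P (k + p + 3, two (n mod p) (n div p)) (e, two n 0)"
      using run_transfer[OF c(3), of "two (n mod p) (n div p)"] by (simp add: mod_mult_div_eq)
    ultimately have "run P (k, two n 0) (e, two n 0)"
      using 1 by (auto intro: run_trans simp del: dvd_eq_mod_eq_0)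
    then show ?thesis using False by simp
  qed
qed

section \<open>Goedel numbers of register contents\<close>

locale prime_family =
  fixes p :: "nat \<Rightarrow> nat"
  assumes prime_p: "prime (p r)" and inj_p: "inj p"
begin

text \<open>Prime factors outside the family are unconstrained, so \<open>s\<close> need not
  determine \<open>n\<close>; \<open>n\<close> determines \<open>s\<close>.\<close>

definition goedel :: "nat \<Rightarrow> (nat \<Rightarrow> nat) \<Rightarrow> bool" where
  "goedel n s \<longleftrightarrow> n > 0 \<and> (\<forall>r. multiplicity (p r) n = s r)"

text \<open>This turns the zero test of a register into a divisibility test.\<close>

lemma goedel_dvd: "goedel n s \<Longrightarrow> p r dvd n \<longleftrightarrow> s r \<noteq> 0"
  unfolding goedel_def
  using prime_multiplicity_gt_zero_iff[OF prime_imp_prime_elem[OF prime_p], of n r] by auto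

lemma multiplicity_p: "multiplicity (p i) (p r) = of_bool (i = r)"
  using prime_multiplicity_other[OF prime_p prime_p, of i r] inj_p prime_p[of r]
  by (auto simp: inj_eq prime_gt_1_nat)

lemma goedel_mult: "goedel n s \<Longrightarrow> goedel (n * p r) (s(r := Suc (s r)))"
  unfolding goedel_def
  using prime_elem_multiplicity_mult_distrib[OF prime_imp_prime_elem[OF prime_p], of n "p r"] prime_gt_0_nat[OF prime_p[of r]]
  by (auto simp: multiplicity_p)

text \<open>As \<open>n\<close> determines \<open>s\<close>, the rule for multiplication, applied to
  the quotient, can be read backwards.\<close>

lemma goedel_div:
  assumes "goedel n s" "s r = Suc m"
  shows "goedel (n div p r) (s(r := m))"
proof -
  have "p r dvd n" using goedel_dvd[OF assms(1)] assms(2) by simp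
  then obtain q where q: "n = q * p r" by (metis dvd_def mult.commute)
  then have "q > 0" using assms(1) by (auto simp: goedel_def)
  then have "goedel q (\<lambda>i. multiplicity (p i) q)" by (simp add: goedel_def)
  from goedel_mult[OF this, of r] have "s = (\<lambda>i. multiplicity (p i) q)(r := Suc (multiplicity (p r) q))"
    using assms(1) unfolding goedel_def q by auto
  then have "s(r := m) = (\<lambda>i. multiplicity (p i) q)" using assms(2) by auto
  moreover have "n div p r = q" using q prime_gt_0_nat[OF prime_p[of r]] by simp
  ultimately show ?thesis using \<open>goedel q _\<close> by simp
qed

lemma goedel_power: "goedel (p r ^ x) ((\<lambda>_. 0)(r := x))"
proof (induction x)
  case 0
  then show ?case by (simp add: goedel_def)
next
  case (Suc x)
  from goedel_mult[OF Suc, of r] show ?case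
    by (simp only: fun_upd_same fun_upd_upd power_Suc mult.commute)
qed

text \<open>Jumps are absolute, so the code depends on its start \<open>k\<close>. It begins and
  ends with an empty second counter and exits just past its end, so that blocks can be
  concatenated.\<close>

definition realizes :: "instr list \<Rightarrow> nat \<Rightarrow> com \<Rightarrow> bool" where
  "realizes xs k c \<longleftrightarrow> (\<forall>P s t n. code_at P k xs \<longrightarrow> exec c s t \<longrightarrow> goedel n s \<longrightarrow>
     (\<exists>n'. goedel n' t \<and> run P (k, two n 0) (k + length xs, two n' 0)))"

lemma realizable: "k \<noteq> 0 \<Longrightarrow> \<exists>xs. realizes xs k c"
proof (induction c arbitrary: k)
  case Skip
  have "realizes [] k Skip"
    unfolding realizes_def by (auto elim: exec.cases intro: run_refl)
  then show ?case ..
next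
  case (Incr r)
  have "realizes (mul_code (p r) k) k (Incr r)"
    unfolding realizes_def
  proof (intro allI impI)
    fix P s t n assume "code_at P k (mul_code (p r) k)" "exec (Incr r) s t" "goedel n s"
    moreover from this(2) have "t = s(r := Suc (s r))" by cases
    ultimately show "\<exists>n'. goedel n' t \<and> run P (k, two n 0) (k + length (mul_code (p r) k), two n' 0)"
      using run_mul_code goedel_mult by (fastforce simp: add.assoc)
  qed
  then show ?case ..
next
  case (Seq c c')
  from Seq obtain xs where xs: "realizes xs k c" by blast
  from Seq obtain ys where ys: "realizes ys (k + length xs) c'" by (metis add_is_0)
  have "realizes (xs @ ys) k (Seq c c')"
    unfolding realizes_def
  proof (intro allI impI)
    fix P s t n assume a: "code_at P k (xs @ ys)" "exec (Seq c c') s t" "goedel n s"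
    from a(2) obtain u where u: "exec c s u" "exec c' u t" by cases
    from xs a u obtain n1 where 1: "goedel n1 u" "run P (k, two n 0) (k + length xs, two n1 0)"
      unfolding realizes_def code_at_append by blast
    from ys a u 1 obtain n2 where 2: "goedel n2 t"
      "run P (k + length xs, two n1 0) (k + length xs + length ys, two n2 0)"
      unfolding realizes_def code_at_append by blast
    show "\<exists>n'. goedel n' t \<and> run P (k, two n 0) (k + length (xs @ ys), two n' 0)"
      using 2(1) run_trans[OF 1(2) 2(2)] by (auto simp: add.assoc)
  qed
  then show ?case ..
next
  case (Loop r c)
  \<comment> \<open>The division tests and decrements register \<open>r\<close> at once; its code
    has length \<open>2 * p r + 4\<close>. If it fails, the number is restored and the loop is left
    to \<open>?e\<close>; after the body, \<open>Jzd True k k\<close> jumps back, the second counter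
    being empty.\<close>
  let ?b = "k + (2 * p r + 4)"
  from Loop obtain xs where xs: "realizes xs ?b c" by (metis add_is_0)
  let ?e = "?b + length xs + 1"
  let ?ys = "div_code (p r) k ?b ?e @ xs @ [Jzd True k k]"
  have len: "k + length ?ys = ?e" by simp
  have "realizes ?ys k (Loop r c)"
    unfolding realizes_def len
  proof (intro allI impI)
    fix P s t n assume P: "code_at P k ?ys" and ex: "exec (Loop r c) s t" and g: "goedel n s"
    from P have cd: "code_at P k (div_code (p r) k ?b ?e)" "code_at P ?b xs"
      "code_at P (?b + length xs) [Jzd True k k]" by (simp_all add: code_at_append)
    have p0: "p r > 0" using prime_gt_0_nat[OF prime_p] .
    from ex g show "\<exists>n'. goedel n' t \<and> run P (k, two n 0) (?e, two n' 0)"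
    proof (induction "Loop r c" s t arbitrary: n rule: exec.induct)
      case (exec_Loop0 s)
      then have "\<not> p r dvd n" using goedel_dvd by simp
      then show ?case using run_div_code[OF cd(1) p0, of n] exec_Loop0 by auto
    next
      case (exec_LoopS s m t u)
      have "p r dvd n" using goedel_dvd[OF exec_LoopS.prems] exec_LoopS by simp
      then have 1: "run P (k, two n 0) (?b, two (n div p r) 0)"
        using run_div_code[OF cd(1) p0, of n] by simp
      have "goedel (n div p r) (s(r := m))" using goedel_div exec_LoopS by blast
      then obtain n1 where n1: "goedel n1 t" "run P (?b, two (n div p r) 0) (?b + length xs, two n1 0)"
        using xs cd(2) exec_LoopS(2) unfolding realizes_def by blast
      have "step P (?b + length xs + 0, two n1 0) = (k, two n1 0)"
        by (subst step_Jzd[OF cd(3)]) auto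
      then have 2: "run P (?b + length xs, two n1 0) (k, two n1 0)"
        by (auto intro: run_step run_refl)
      from exec_LoopS(5)[OF n1(1)] obtain n2 where
        "goedel n2 u" "run P (k, two n1 0) (?e, two n2 0)" by blast
      then show ?case using 1 n1(2) 2 by (blast intro: run_trans)
    qed
  qed
  then show ?case ..
qed

end

text \<open>With \<open>p 0 = 2\<close>, the loaded number \<open>2 ^ x\<close> is a Goedel number
  of the state that holds \<open>x\<close> in register 0 and 0 elsewhere.\<close>

lemma prime_family_exists: "\<exists>p. prime_family p \<and> p 0 = 2"
proof -
  have "infinite ({q::nat. prime q} - {2})" using primes_infinite by simp
  then obtain f :: "nat \<Rightarrow> nat" where f: "inj f" "range f \<subseteq> {q. prime q} - {2}"
    using infinite_countable_subset by blast
  have "prime_family (case_nat 2 f)"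
  proof
    show "prime (case_nat 2 f r)" for r using f(2) by (cases r) auto
    show "inj (case_nat 2 f)"
      using f by (auto simp: inj_def split: nat.splits) (metis Diff_iff insertI1 rangeI subsetD)+
  qed
  then show ?thesis by (intro exI[of _ "case_nat 2 f"]) simp
qed

text \<open>Both \<open>d\<close> and a halting configuration would persist forever, so they would
  meet at a common later time.\<close>

lemma not_halts_if_stuck:
  assumes "run P c d" "step P d = d" "fst d \<noteq> 0"
  shows "\<not> halts P c"
proof
  assume "halts P c"
  then obtain m where m: "fst ((step P ^^ m) c) = 0" by (auto simp: halts_def)
  obtain j where j: "(step P ^^ j) c = d" using assms(1) by (auto simp: run_def)
  have "(step P ^^ (i + j)) c = d" for i using j assms(2) by (induction i) auto
  moreover have "fst ((step P ^^ (i + m)) c) = 0" for i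
  proof (induction i)
    case (Suc i)
    then show ?case by (cases "(step P ^^ (i + m)) c") simp
  qed (simp add: m)
  ultimately show False using assms(3) by (metis add.commute)
qed

lemma halts_if_run: "run P c d \<Longrightarrow> fst d = 0 \<Longrightarrow> halts P c"
  by (auto simp: run_def halts_def)

text \<open>Both counters start with the same number, but the code blocks expect an empty second
  counter. With \<open>e = 2\<close> and \<open>k = 1\<close> this is also the test demanded of
  \<open>P ! 1\<close>.\<close>

lemma run_drain:
  assumes "code_at P k [Jzd True (e) k]"
  shows "run P (k, two a b) (e, two a 0)"
proof (induction b)
  case 0
  have "step P (k + 0, two a 0) = (e, two a 0)" by (subst step_Jzd[OF assms]) auto
  then show ?case by (auto intro: run_step run_refl)
next
  case (Suc b)
  have "step P (k + 0, two a (Suc b)) = (k, two a b)" by (subst step_Jzd[OF assms]) auto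
  then show ?case using Suc by (auto intro: run_step)
qed

section \<open>Recursiveness of the reduction\<close>

text \<open>Arguments form one list, so closure properties apply to terms in \<open>xs\<close>
  directly as introduction rules.\<close>

definition recursive :: "nat \<Rightarrow> (nat list \<Rightarrow> nat) \<Rightarrow> bool" where
  "recursive n F \<longleftrightarrow> (\<exists>f. \<forall>xs. length xs = n \<longrightarrow> rec_eval f xs (F xs))"

lemma recursive_nth: "i < n \<Longrightarrow> recursive n (\<lambda>xs. xs ! i)"
  unfolding recursive_def by (auto intro: ev_Id)

lemma recursive_comp:
  assumes G: "recursive (length Fs) G" and Fs: "\<And>F. F \<in> set Fs \<Longrightarrow> recursive n F"
  shows "recursive n (\<lambda>xs. G (map (\<lambda>F. F xs) Fs))"
proof -
  obtain g where g: "\<And>ys. length ys = length Fs \<Longrightarrow> rec_eval g ys (G ys)"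
    using G unfolding recursive_def by blast
  obtain code where code: "\<And>F xs. F \<in> set Fs \<Longrightarrow> length xs = n \<Longrightarrow> rec_eval (code F) xs (F xs)"
    using Fs unfolding recursive_def by metis
  have "rec_eval (Cn g (map code Fs)) xs (G (map (\<lambda>F. F xs) Fs))" if "length xs = n" for xs
    using code that by (intro ev_Cn[OF _ g]) (auto simp: list_all2_conv_all_nth)
  then show ?thesis unfolding recursive_def by blast
qed

lemma recursive_comp1:
  "recursive 1 G \<Longrightarrow> recursive n F \<Longrightarrow> recursive n (\<lambda>xs. G [F xs])"
  using recursive_comp[of "[F]" G n] by simp

lemma recursive_Suc: "recursive n F \<Longrightarrow> recursive n (\<lambda>xs. Suc (F xs))"
proof -
  have "recursive 1 (\<lambda>xs. Suc (hd xs))"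
    unfolding recursive_def by (auto intro!: exI[of _ S] ev_S simp: length_Suc_conv)
  then show "recursive n F \<Longrightarrow> recursive n (\<lambda>xs. Suc (F xs))"
    using recursive_comp1 by fastforce
qed

lemma recursive_const: "recursive n (\<lambda>_. k)"
proof (induction k)
  case 0
  then show ?case unfolding recursive_def by (blast intro: ev_Z)
qed (rule recursive_Suc)

lemma recursive_rec_nat:
  assumes G: "recursive n G" and H: "recursive (Suc (Suc n)) H"
  shows "recursive (Suc n) (\<lambda>xs. rec_nat (G (tl xs)) (\<lambda>m y. H (m # y # tl xs)) (hd xs))"
proof -
  obtain g where g: "\<And>xs. length xs = n \<Longrightarrow> rec_eval g xs (G xs)"
    using G unfolding recursive_def by blast
  obtain h where h: "\<And>xs. length xs = Suc (Suc n) \<Longrightarrow> rec_eval h xs (H xs)"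
    using H unfolding recursive_def by blast
  have "rec_eval (Pr g h) (m # xs) (rec_nat (G xs) (\<lambda>m y. H (m # y # xs)) m)"
    if "length xs = n" for m xs
    by (induction m) (auto intro!: ev_Pr0 ev_PrS g h simp: that)
  then show ?thesis unfolding recursive_def
    by (intro exI[of _ "Pr g h"]) (auto simp: length_Suc_conv)
qed

text \<open>The recursion argument may be any recursive \<open>F\<close>: composing with
  \<open>F\<close> and the \<open>n\<close> projections supplies the list
  \<open>F xs # xs\<close>.\<close>

lemma recursive_rec_nat':
  assumes "recursive n F" "recursive n G" and H: "recursive (Suc (Suc n)) (\<lambda>xs. H (xs ! 0) (xs ! 1) (drop 2 xs))"
  shows "recursive n (\<lambda>xs. rec_nat (G xs) (\<lambda>m y. H m y xs) (F xs))"
proof -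
  let ?Fs = "F # map (\<lambda>i xs. xs ! i) [0..<n]"
  have rec: "recursive (length ?Fs) (\<lambda>xs. rec_nat (G (tl xs)) (\<lambda>m y. H m y (tl xs)) (hd xs))"
    using recursive_rec_nat[OF assms(2) H] by simp
  have Fs: "recursive n F'" if "F' \<in> set ?Fs" for F'
    using that assms(1) by (auto intro: recursive_nth)
  obtain f where f: "\<And>xs. length xs = n \<Longrightarrow> rec_eval f xs
    ((\<lambda>xs. rec_nat (G (tl xs)) (\<lambda>m y. H m y (tl xs)) (hd xs)) (map (\<lambda>F. F xs) ?Fs))"
    using recursive_comp[OF rec Fs] unfolding recursive_def by blast
  have "rec_eval f xs (rec_nat (G xs) (\<lambda>m y. H m y xs) (F xs))" if "length xs = n" for xs
  proof -
    have "map (\<lambda>F. F xs) ?Fs = F xs # xs"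
      using that by (auto simp: comp_def intro: nth_equalityI)
    then show ?thesis using f[OF that] by simp
  qed
  then show ?thesis unfolding recursive_def by blast
qed

section \<open>Closure under arithmetic and pairing\<close>

lemma recursive_add:
  assumes "recursive n F" "recursive n G"
  shows "recursive n (\<lambda>xs. F xs + G xs)"
proof -
  have "recursive n (\<lambda>xs. rec_nat (G xs) (\<lambda>m y. Suc y) (F xs))"
    using assms by (intro recursive_rec_nat' recursive_Suc recursive_nth) auto
  moreover have "rec_nat b (\<lambda>m y. Suc y) a = a + b" for a b
    by (induction a) auto
  ultimately show ?thesis by simp
qed

lemma recursive_triangle:
  assumes "recursive n F"
  shows "recursive n (\<lambda>xs. triangle (F xs))"
proof -
  have "recursive n (\<lambda>xs. rec_nat 0 (\<lambda>m y. y + Suc m) (F xs))"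
    using assms by (intro recursive_rec_nat' recursive_add recursive_Suc recursive_nth recursive_const) auto
  moreover have "rec_nat 0 (\<lambda>m y. y + Suc m) a = triangle a" for a
    by (induction a) auto
  ultimately show ?thesis by simp
qed

lemma recursive_power2:
  assumes "recursive n F"
  shows "recursive n (\<lambda>xs. 2 ^ F xs)"
proof -
  have "recursive n (\<lambda>xs. rec_nat 1 (\<lambda>m y. y + y) (F xs))"
    using assms by (intro recursive_rec_nat' recursive_add recursive_nth recursive_const) auto
  moreover have "rec_nat 1 (\<lambda>m y. y + y) a = (2::nat) ^ a" for a
    by (induction a) auto
  ultimately show ?thesis by simp
qed

text \<open>This is the nonempty case of \<open>list_encode\<close>, as a function on codes.\<close>

definition cons_code :: "nat \<Rightarrow> nat \<Rightarrow> nat" where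
  "cons_code x y = Suc (prod_encode (x, y))"

lemma recursive_cons_code:
  assumes "recursive n F" "recursive n G"
  shows "recursive n (\<lambda>xs. cons_code (F xs) (G xs))"
  unfolding cons_code_def prod_encode_def
  using assms by (auto intro!: recursive_Suc recursive_add recursive_triangle)

section \<open>Codes of the constructed automata\<close>

definition link_code :: "bool \<Rightarrow> nat \<Rightarrow> nat" where
  "link_code z n = encode_trans (2 * n + 3, z, 0, 1, 2 * n + 1)"

lemma recursive_link_code:
  assumes "recursive n F"
  shows "recursive n (\<lambda>xs. link_code z (F xs))"
proof -
  have "link_code z m = cons_code (m + m + 3) (cons_code (of_bool z) (cons_code 0
    (cons_code (int_encode 1) (cons_code (m + m + 1) 0))))" for m
    by (simp add: link_code_def encode_trans_def cons_code_def)
  then show ?thesis using assms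
    by (simp only:) (intro recursive_cons_code recursive_add recursive_const)
qed

text \<open>As \<open>chain\<close> only puts transitions in front of \<open>T\<close>, its code is
  obtained from the code \<open>x\<close> of \<open>T\<close> without decoding
  \<open>x\<close>.\<close>

definition chain_code :: "nat \<Rightarrow> nat \<Rightarrow> nat" where
  "chain_code x n = rec_nat x (\<lambda>m y. cons_code (link_code True m) (cons_code (link_code False m) y)) n"

lemma chain_code:
  "chain_code (list_encode (map encode_trans T)) n = list_encode (map encode_trans (chain T n))"
  by (induction n) (simp_all add: chain_code_def link_code_def cons_code_def)

definition machine_oca_code :: "nat \<Rightarrow> nat" where
  "machine_oca_code x = cons_code (2 ^ x + 2 ^ x + 2) (cons_code 2 (cons_code (chain_code x (2 ^ x))
     (cons_code (2 ^ x + 2 ^ x + 1) (cons_code (list_encode [0]) 0))))"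

lemma recursive_machine_oca_code: "recursive 1 (\<lambda>xs. machine_oca_code (xs ! 0))"
  unfolding machine_oca_code_def chain_code_def
  by (intro recursive_cons_code recursive_add recursive_const recursive_power2 recursive_rec_nat'
      recursive_link_code recursive_nth) auto

definition core_code :: "instr list \<Rightarrow> nat" where
  "core_code P = list_encode (map encode_trans (core P))"

lemma machine_oca_code:
  "machine_oca_code (core_code P) = encode_oca (machine_oca P (2 ^ core_code P))"
  by (simp add: machine_oca_code_def encode_oca_def machine_oca_def core_code_def chain_code
      cons_code_def mult_2)

lemma less_list_encode: "x \<in> set xs \<Longrightarrow> x < list_encode xs"
  by (induction xs) (auto simp: le_imp_less_Suc le_prod_encode_1 intro: less_SucI order.strict_trans2 le_prod_encode_2)

text \<open>A state in \<open>core P\<close> is smaller than the code of its transition, which is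
  smaller than \<open>core_code P\<close> and thus than \<open>2 ^ core_code P\<close>.\<close>

lemma machine_oca_wf: "oca_wf (machine_oca P (2 ^ core_code P))"
proof -
  have small: "q < 2 ^ core_code P" "q' < 2 ^ core_code P"
    if "(q, z, a, d, q') \<in> set (core P)" for q z a d q'
  proof -
    have "encode_trans (q, z, a, d, q') < core_code P"
      unfolding core_code_def using that by (intro less_list_encode) force
    moreover have "q < encode_trans (q, z, a, d, q')" "q' < encode_trans (q, z, a, d, q')"
      unfolding encode_trans_def prod.case by (rule less_list_encode; simp)+
    moreover have "core_code P < 2 ^ core_code P" by (rule less_exp)
    ultimately show "q < 2 ^ core_code P" "q' < 2 ^ core_code P" by linarith+
  qed
  have rest: "a < 2" "d \<in> {-1, 0, 1}" if "(q, z, a, d, q') \<in> set (core P)" for q z a d q'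
    using that branch_cases
    by (auto simp: core_iff instr_trans_def case_prod_beta split: if_splits)
  show ?thesis
    unfolding oca_wf_def machine_oca_simps
  proof (intro conjI ballI, goal_cases)
    case (3 t)
    obtain q z a d q' where t: "t = (q, z, a, d, q')" by (cases t)
    from 3 consider "(q, z, a, d, q') \<in> set (core P)"
      | j where "j < 2 ^ core_code P" "(q, z, a, d, q') = (2 * j + 3, z, 0, 1, 2 * j + 1)"
      unfolding t by (auto simp: machine_oca_def set_chain)
    then show ?case
    proof cases
      case 1
      then show ?thesis using small[OF 1] rest[OF 1] by (simp add: t machine_oca_def)
    next
      case 2
      then show ?thesis by (simp add: t machine_oca_def)
    qed
  qed (simp_all add: machine_oca_def)
qed

section \<open>Undecidability\<close>

theorem theorem6:
  shows "\<not> oca_problem_decidable history_deterministic"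
proof
  assume "oca_problem_decidable history_deterministic"
  then obtain f where f: "\<And>A. oca_wf A \<Longrightarrow>
    rec_eval f [encode_oca A] (if history_deterministic A then 1 else 0)"
    unfolding oca_problem_decidable_def by blast
  obtain h where "\<And>xs. length xs = 1 \<Longrightarrow> rec_eval h xs (machine_oca_code (xs ! 0))"
    using recursive_machine_oca_code unfolding recursive_def by blast
  from this[of "[_]"] have h: "rec_eval h [x] (machine_oca_code x)" for x by simp
  \<comment> \<open>The argument is in register 0, the answer goes to register 1, and scratch space
    starts at 2.\<close>
  obtain c where c: "implements c (Cn f [h]) [0] 1 2"
    using compilableD[OF recf_compilable, of "[0]" 2 1] by auto
  obtain p where "prime_family p" and p0: "p 0 = 2" using prime_family_exists by blast
  then interpret prime_family p by simp
  obtain xs where xs: "realizes xs 2 c" using realizable[of 2] by auto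
  let ?k = "2 + length xs"
  let ?e = "?k + (2 * p 1 + 4)"
  \<comment> \<open>Index 0 is a placeholder for the halting label, and label 1 empties the second
    counter. After the simulation of the decider, divisibility by \<open>p 1\<close> means answer 1
    and leads to label 0; otherwise the last instruction loops forever.\<close>
  define P where "P = Inc False 0 # [Jzd True 2 1] @ xs @ div_code (p 1) ?k 0 ?e @ [Jzd True ?e ?e]"
  have "code_at P 1 ([Jzd True 2 1] @ xs @ div_code (p 1) ?k 0 ?e @ [Jzd True ?e ?e])"
    unfolding P_def by (rule code_at_Cons)
  then have "code_at P 1 [Jzd True 2 1] \<and> code_at P (1 + 1) xs \<and>
    code_at P (1 + 1 + length xs) (div_code (p 1) ?k 0 ?e) \<and>
    code_at P (1 + 1 + length xs + (2 * p 1 + 4)) [Jzd True ?e ?e]"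
    unfolding code_at_append length_div_code by simp
  then have cd: "code_at P 1 [Jzd True 2 1]" "code_at P 2 xs"
    "code_at P ?k (div_code (p 1) ?k 0 ?e)" "code_at P ?e [Jzd True ?e ?e]"
    unfolding one_add_one by blast+
  \<comment> \<open>\<open>P\<close> is built without reference to \<open>x\<close>; the
    self-reference arises only because the loaded number hands \<open>P\<close> its own
    code.\<close>
  define x where "x = core_code P"
  let ?A = "machine_oca P (2 ^ x)" and ?s = "(\<lambda>_. 0)(0 := x)"
  let ?v = "if history_deterministic ?A then 1 else 0 :: nat"
  have "rec_eval f [machine_oca_code x] ?v"
    unfolding x_def machine_oca_code by (rule f[OF machine_oca_wf])
  with h[of x] have "rec_eval (Cn f [h]) (map ?s [0]) ?v"
    by (auto intro!: ev_Cn[of _ _ "[machine_oca_code x]"])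
  then have ex: "exec c ?s (?s(1 := ?v))"
    by (intro implementsD[OF c]) simp_all
  have "goedel (2 ^ x) ?s" using goedel_power[of 0 x] p0 by simp
  then obtain n where n: "goedel n (?s(1 := ?v))" "run P (2, two (2 ^ x) 0) (?k, two n 0)"
    using xs cd(2) ex unfolding realizes_def by blast
  have "(\<lambda>_. 2 ^ x) = two (2 ^ x) (2 ^ x)" by (auto simp: two_def)
  then have start: "run P (1, \<lambda>_. 2 ^ x) (?k, two n 0)"
    using run_trans[OF run_drain[OF cd(1)]] n(2) by simp
  have final: "run P (?k, two n 0) (if p 1 dvd n then (0, two (n div p 1) 0) else (?e, two n 0))"
    using run_div_code[OF cd(3) prime_gt_0_nat[OF prime_p]] .
  have dvd: "p 1 dvd n \<longleftrightarrow> history_deterministic ?A" using goedel_dvd[OF n(1), of 1] by simp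
  show False
  proof (cases "history_deterministic ?A")
    case True
    then have "run P (?k, two n 0) (0, two (n div p 1) 0)" using final dvd by simp
    then have "halts P (1, \<lambda>_. 2 ^ x)" using halts_if_run[OF run_trans[OF start]] by simp
    then have "\<not> history_deterministic ?A"
      by (intro not_history_deterministic_if_halts) (simp_all add: P_def)
    then show False using True by simp
  next
    case False
    then have "run P (?k, two n 0) (?e, two n 0)" using final dvd by simp
    moreover have "step P (?e + 0, two n 0) = (?e, two n 0)" by (subst step_Jzd[OF cd(4)]) auto
    ultimately have "\<not> halts P (1, \<lambda>_. 2 ^ x)"
      using not_halts_if_stuck[OF run_trans[OF start]] by simp
    then have "history_deterministic ?A" by (intro history_deterministic_if_not_halts) simp_all
    then show False using False by simp
  qed
qed

end
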